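(* Let $X:SU(2)\to\mathbb{C}$ be a $2$-weakly left-invariant random field with coefficients $a^\ell_{m,s}$, i.e. $X=\sum_{\ell,m,s}a^\ell_{m,s}\phi^\ell_{m,s}$, and let $X^\ell_{\bullet,s}=\sum_{m=-\ell}^{\ell}a^\ell_{m,s}\phi^\ell_{m,s}$. Then $\mathbb{E}\{a^\ell_{m,s}\}=0$ whenever $\ell\neq0$. Moreover, the random variables $a^\ell_{m,s}$ have the following correlation structure: $$\mathbb{E}\left\{\overline{a^\ell_{m,s}}\,a^{\ell'}_{m',s'}\right\}=\delta_{m,m'}\frac{\delta_{\ell,\ell'}}{2\ell+1}\,\mathbb{E}\left\{\langle X^\ell_{\bullet,s},X^\ell_{\bullet,s'}\rangle_{L^2(SU(2))}\right\}.$$ In particular, the variance of $a^\ell_{m,s}$ does not depend on $m$. Furthermore, $$\mathbb{E}\left\{a^\ell_{m,s}a^{\ell'}_{m',s'}\right\}=\delta_{-m,m'}(-1)^{\ell-m}\frac{\delta_{\ell,\ell'}}{2\ell+1}\left(\sum_{k=-\ell}^{\ell}(-1)^{\ell+k}\,\mathbb{E}\left\{a^\ell_{k,s}a^\ell_{-k,s'}\right\}\right).$$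
   Context: $\frac12\mathbb{N}=\{0,\frac12,1,\dots\}$; $\ell,\ell'\in\frac12\mathbb{N}$, $m,s\in\{-\ell,\dots,\ell\}$, $m',s'\in\{-\ell',\dots,\ell'\}$, indices running in steps of 1 (for $\ell\ne\ell'$ the right-hand sides are $0$). Elements of $SU(2)$ are $h(\alpha,\beta)=\begin{pmatrix}\alpha&-\overline\beta\\ \beta&\overline\alpha\end{pmatrix}$, $|\alpha|^2+|\beta|^2=1$; $SU(2)$ carries the metric of the round 3-sphere of radius 2 (volume $16\pi^2$). $\langle F,G\rangle_{L^2(SU(2))}=\int\overline{F}G\,d\mathrm{vol}$. Wigner functions: with $\psi^\ell_m(z_0,z_1)=\binom{2\ell}{\ell+m}^{1/2}z_0^{\ell+m}z_1^{\ell-m}$, $D^\ell_{m,s}:SU(2)\to\mathbb{C}$ is defined by $\sum_m\psi^\ell_m(z_0,z_1)D^\ell_{m,s}(h(\alpha,\beta))=\psi^\ell_s(\overline\alpha z_0+\overline\beta z_1,-\beta z_0+\alpha z_1)$ for all $z_0,z_1\in\mathbb{C}$. The functions $\phi^\ell_{m,s}=\frac{\sqrt{2\ell+1}}{4\pi}D^\ell_{m,s}$ form an orthonormal basis of $L^2(SU(2))$. A random field is a measurable $X:\Omega\times SU(2)\to\mathbb{C}$, with $\Omega$ a probability space. $X$ is $2$-weakly left-invariant if $\mathbb{E}|X(g)|<\infty$ for every $g\in SU(2)$ and, for every left multiplication $\phi=L_h:g\mapsto hg$, $h\in SU(2)$, the fields $X$ and $X\circ\phi$ have the same joint moments of order up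 to 2: $\mathbb{E}\{c^i(X(\phi(g_1)))\,c^j(X(\phi(g_2)))\}=\mathbb{E}\{c^i(X(g_1))\,c^j(X(g_2))\}$ for every $i,j\in\{0,1\}$ and $g_1,g_2\in SU(2)$, where $c(z)=\overline z$ (and $c^0$ is the identity). Such a field is almost surely in $L^2(SU(2))$, and $a^\ell_{m,s}$ are its coefficients in the orthonormal basis $\phi^\ell_{m,s}$.
   Formalization: The first correlation formula is proved as printed for s=s', and for all s,s' with Σ_k E{conj(a_{k,s}) a_{k,s'}} as the last factor; the second as printed for s=s' or integer ℓ, and in general with (-1)^{ℓ-k} in the sum; equal means and E|X(g)|²<∞ are part of invariance. *)

theory Defs
  imports "HOL-Probability.Probability"
begin

section \<open>The group SU(2) and its volume measure\<close>

definition SU2_mat :: "complex \<Rightarrow> complex \<Rightarrow> complex^2^2" where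
  "SU2_mat \<alpha> \<beta> = vector [vector [\<alpha>, - cnj \<beta>], vector [\<beta>, cnj \<alpha>]]"

definition SU2 :: "(complex^2^2) set" where
  "SU2 = {SU2_mat \<alpha> \<beta> |\<alpha> \<beta>. (cmod \<alpha>)\<^sup>2 + (cmod \<beta>)\<^sup>2 = 1}"

text \<open>
  \<open>SU2_mat \<alpha> \<beta>\<close> corresponds to the point \<open>(2\<alpha>, 2\<beta>)\<close> of the sphere of radius 2 in the
  4-dimensional Euclidean space \<open>complex \<times> complex\<close>. The surface measure of the sphere of
  radius \<open>r\<close> in dimension \<open>n\<close> gives a set \<open>A\<close> the mass \<open>n / r\<close> times the Lebesgue measure of
  the cone \<open>{t x |t x. x \<in> A \<and> 0 < t < 1}\<close>; here \<open>n / r = 4 / 2 = 2\<close>. Equivalently, it is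
  \<open>n / r\<close> times the image of Lebesgue measure on the punctured ball of radius \<open>r\<close> under
  radial projection.
\<close>

definition vol_SU2 :: "(complex^2^2) measure" where
  "vol_SU2 = scale_measure 2
     (distr (restrict_space lborel (ball 0 2 - {0})) (restrict_space borel SU2)
        (\<lambda>z :: complex \<times> complex. SU2_mat (fst z / norm z) (snd z / norm z)))"

lemma borel_measurable_SU2_mat_proj:
  "(\<lambda>z :: complex \<times> complex. SU2_mat (fst z / norm z) (snd z / norm z))
     \<in> borel_measurable borel"
proof -
  have e: "SU2_mat x y =
      (\<chi> i j. if i = 1 then (if j = 1 then x else - cnj y) else (if j = 1 then y else cnj x))" for x y
    by (simp add: SU2_mat_def vec_eq_iff forall_2)
  have c: "continuous_on UNIV (\<lambda>p. SU2_mat (fst p) (snd p))"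
    unfolding e by (intro continuous_on_vec_lambda, rename_tac i j,
        case_tac "i = 1"; case_tac "j = 1")
       (auto intro!: continuous_intros)
  have b: "(\<lambda>p. SU2_mat (fst p) (snd p)) \<in> borel_measurable borel"
    by (rule borel_measurable_continuous_onI[OF c])
  have "(\<lambda>z :: complex \<times> complex. (fst z / norm z, snd z / norm z)) \<in> borel_measurable borel"
    by (intro borel_measurable_Pair borel_measurable_divide)
       (auto intro!: borel_measurable_continuous_onI continuous_intros)
  from measurable_compose[OF this b] show ?thesis by simp
qed

lemma emeasure_vol_SU2: "emeasure vol_SU2 (space vol_SU2) = ennreal (16 * pi\<^sup>2)"
proof -
  let ?S = "ball 0 2 - {0} :: (complex \<times> complex) set"
  let ?f = "\<lambda>z :: complex \<times> complex. SU2_mat (fst z / norm z) (snd z / norm z)"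
  have in_SU2: "?f z \<in> SU2" if "z \<in> ?S" for z
  proof -
    have "(norm z)\<^sup>2 = (cmod (fst z))\<^sup>2 + (cmod (snd z))\<^sup>2" by (simp add: norm_prod_def)
    with that show ?thesis unfolding SU2_def
      by (auto simp: norm_divide power_divide add_divide_distrib[symmetric] intro!: exI)
  qed
  have m: "?f \<in> measurable (restrict_space lborel ?S) (restrict_space borel SU2)"
    using borel_measurable_SU2_mat_proj in_SU2
    by (intro measurable_restrict_space2 measurable_restrict_space1)
       (auto simp: space_restrict_space)
  have "emeasure vol_SU2 (space vol_SU2) =
      2 * emeasure (distr (restrict_space lborel ?S) (restrict_space borel SU2) ?f) SU2"
    by (simp add: vol_SU2_def space_restrict_space space_scale_measure)
  also have "emeasure (distr (restrict_space lborel ?S) (restrict_space borel SU2) ?f) SU2 =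
      emeasure (restrict_space lborel ?S) ?S"
    using in_SU2 by (subst emeasure_distr[OF m]) (auto simp: space_restrict_space sets_restrict_space
        intro!: arg_cong2[where f = emeasure])
  also have "\<dots> = emeasure lborel ?S" by (subst emeasure_restrict_space) auto
  also have "\<dots> = emeasure lborel (ball 0 2 :: (complex \<times> complex) set)"
    by (subst emeasure_Diff) auto
  also have "\<dots> = ennreal (unit_ball_vol 4 * 2 ^ 4)" by (subst emeasure_ball) auto
  finally show ?thesis
    by (simp add: unit_ball_vol_numeral fact_numeral eval_nat_numeral ennreal_mult'[symmetric]
        flip: ennreal_numeral)
qed

definition inner_SU2 ::
  "((complex^2^2) \<Rightarrow> complex) \<Rightarrow> ((complex^2^2) \<Rightarrow> complex) \<Rightarrow> complex" where
  "inner_SU2 F G = (\<integral>g. cnj (F g) * G g \<partial>vol_SU2)"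


section \<open>Wigner functions\<close>

text \<open>
  Half-integers are real numbers. For admissible indices the arguments of the floor function
  below are natural numbers, so \<open>nat \<lfloor>_\<rfloor>\<close> is only a conversion of type.
\<close>

definition half_nats :: "real set" where
  "half_nats = {real n / 2 |n :: nat. True}"

definition idx :: "real \<Rightarrow> real set" where
  "idx l = {- l + real k |k :: nat. - l + real k \<le> l}"

definition psi :: "real \<Rightarrow> real \<Rightarrow> complex \<Rightarrow> complex \<Rightarrow> complex" where
  "psi l m z0 z1 =
     complex_of_real (sqrt (real (nat \<lfloor>2 * l\<rfloor> choose nat \<lfloor>l + m\<rfloor>)))
       * z0 ^ nat \<lfloor>l + m\<rfloor> * z1 ^ nat \<lfloor>l - m\<rfloor>"

text \<open>
  The column \<open>m \<mapsto> D l m s g\<close> is the unique family indexed by \<open>idx l\<close> (extended by 0) that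
  satisfies the defining identity. For \<open>g = SU2_mat \<alpha> \<beta>\<close>, \<open>\<alpha> = g $ 1 $ 1\<close> and \<open>\<beta> = g $ 2 $ 1\<close>.
\<close>

definition wigner_D :: "real \<Rightarrow> real \<Rightarrow> real \<Rightarrow> complex^2^2 \<Rightarrow> complex" where
  "wigner_D l m s g =
     (THE d :: real \<Rightarrow> complex.
        (\<forall>k. k \<notin> idx l \<longrightarrow> d k = 0) \<and>
        (\<forall>z0 z1. (\<Sum>k\<in>idx l. psi l k z0 z1 * d k) =
           psi l s (cnj (g $ 1 $ 1) * z0 + cnj (g $ 2 $ 1) * z1)
                   (- (g $ 2 $ 1) * z0 + g $ 1 $ 1 * z1))) m"

definition phi :: "real \<Rightarrow> real \<Rightarrow> real \<Rightarrow> complex^2^2 \<Rightarrow> complex" where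
  "phi l m s g = complex_of_real (sqrt (2 * l + 1) / (4 * pi)) * wigner_D l m s g"


section \<open>Random fields on SU(2)\<close>

definition random_field :: "'w measure \<Rightarrow> ('w \<Rightarrow> complex^2^2 \<Rightarrow> complex) \<Rightarrow> bool" where
  "random_field M X \<longleftrightarrow>
     prob_space M \<and> (\<lambda>(\<omega>, g). X \<omega> g) \<in> borel_measurable (M \<Otimes>\<^sub>M vol_SU2)"

text \<open>
  Moments of order up to 2 include those of order 1. The integral of a non-integrable function
  is 0, so the existence of the moments of order 2 has to be required explicitly; by the
  Cauchy-Schwarz inequality, finiteness of \<open>E |X(g)|\<^sup>2\<close> covers all of them.
\<close>

definition weakly2_left_invariant :: "'w measure \<Rightarrow> ('w \<Rightarrow> complex^2^2 \<Rightarrow> complex) \<Rightarrow> bool" where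
  "weakly2_left_invariant M X \<longleftrightarrow>
     (\<forall>g\<in>SU2. integrable M (\<lambda>\<omega>. X \<omega> g)) \<and>
     (\<forall>g\<in>SU2. integrable M (\<lambda>\<omega>. (cmod (X \<omega> g))\<^sup>2)) \<and>
     (\<forall>h\<in>SU2. \<forall>g\<in>SU2. (\<integral>\<omega>. X \<omega> (h ** g) \<partial>M) = (\<integral>\<omega>. X \<omega> g \<partial>M)) \<and>
     (\<forall>h\<in>SU2. \<forall>i\<in>{0, 1}. \<forall>j\<in>{0, 1}. \<forall>g1\<in>SU2. \<forall>g2\<in>SU2.
        (\<integral>\<omega>. (cnj ^^ i) (X \<omega> (h ** g1)) * (cnj ^^ j) (X \<omega> (h ** g2)) \<partial>M) =
        (\<integral>\<omega>. (cnj ^^ i) (X \<omega> g1) * (cnj ^^ j) (X \<omega> g2) \<partial>M))"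

definition coeff_field ::
  "('w \<Rightarrow> complex^2^2 \<Rightarrow> complex) \<Rightarrow> real \<Rightarrow> real \<Rightarrow> real \<Rightarrow> 'w \<Rightarrow> complex" where
  "coeff_field X l m s \<omega> = inner_SU2 (phi l m s) (X \<omega>)"

definition component_field ::
  "('w \<Rightarrow> complex^2^2 \<Rightarrow> complex) \<Rightarrow> real \<Rightarrow> real \<Rightarrow> 'w \<Rightarrow> complex^2^2 \<Rightarrow> complex" where
  "component_field X l s \<omega> g = (\<Sum>m\<in>idx l. coeff_field X l m s \<omega> * phi l m s g)"

definition complex_variance :: "'w measure \<Rightarrow> ('w \<Rightarrow> complex) \<Rightarrow> real" where
  "complex_variance M Z = (\<integral>\<omega>. (cmod (Z \<omega> - (\<integral>\<omega>'. Z \<omega>' \<partial>M)))\<^sup>2 \<partial>M)"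

end

theory Submission
  imports Defs
begin

text \<open>
  For two fields \<open>X\<close>, \<open>Y\<close> such that \<open>E (cnj (X g) * Y g')\<close> is invariant under simultaneous
  left translation of \<open>g\<close> and \<open>g'\<close>, Fubini's theorem and the left invariance of the volume show
  that the matrix \<open>C\<close> of the correlations \<open>E (cnj a\<^sub>m * b\<^sub>n)\<close> of their coefficients, for fixed
  degrees and fixed \<open>s\<close>, \<open>s'\<close>, satisfies \<open>D(h) C = C D'(h)\<close> for the unitary Wigner matrices
  \<open>D\<close>, \<open>D'\<close>. Instead of Schur's lemma it suffices to insert two kinds of group elements: diagonal
  \<open>h\<close> make \<open>C\<close> diagonal, and a single \<open>h\<close> for which the extreme rows and columns of
  the Wigner matrices have no zero entry makes the diagonal constant, and zero if the degrees differ.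

  The theorem consists of three instances: the pair \<open>(X, X)\<close> gives the correlations, the pair
  \<open>(1, X)\<close> gives the means because the constant field has a non-zero coefficient of degree 0,
  and the pair \<open>(cnj X, X)\<close> together with the symmetry of \<open>D\<close> under conjugation gives the
  correlations without conjugate.
\<close>

section \<open>Wigner matrices\<close>

lemma half_nats_cases:
  assumes "l \<in> half_nats"
  obtains n where "l = real n / 2"
  using assms by (auto simp: half_nats_def)

text \<open>The substitution \<open>n = 2 * l\<close>, \<open>i = l + k\<close> turns half-integer
  indices into natural numbers \<open>i \<le> n\<close>, which then serve as exponents and binomial
  arguments.\<close>

lemma idx_half_nat: "idx (real n / 2) = (\<lambda>i. real i - real n / 2) ` {..n}"
  by (auto simp: idx_def image_iff Bex_def intro: exI[of _ "_ :: nat"])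

lemma idx_half_nat_cases:
  assumes "k \<in> idx (real n / 2)"
  obtains i where "i \<le> n" "k = real i - real n / 2"
  using assms unfolding idx_half_nat by (elim imageE) simp

lemma finite_idx: "l \<in> half_nats \<Longrightarrow> finite (idx l)"
  by (elim half_nats_cases) (simp only: idx_half_nat finite_imageI finite_atMost)

lemma sum_idx_half_nat:
  "(\<Sum>k\<in>idx (real n / 2). f k) = (\<Sum>i\<le>n. f (real i - real n / 2))"
  unfolding idx_half_nat by (subst sum.reindex) (auto simp: inj_on_def)

lemma card_idx: "l \<in> half_nats \<Longrightarrow> real (card (idx l)) = 2 * l + 1"
  using sum_idx_half_nat[of "\<lambda>_. 1::real"] by (auto elim!: half_nats_cases)

lemma idx_uminus: "l \<in> half_nats \<Longrightarrow> k \<in> idx l \<Longrightarrow> - k \<in> idx l"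
proof -
  assume "l \<in> half_nats" "k \<in> idx l"
  then obtain n where l: "l = real n / 2" and "k \<in> idx (real n / 2)" by (metis half_nats_cases)
  from this(2) obtain i where "i \<le> n" "k = real i - real n / 2" by (rule idx_half_nat_cases)
  then have "- k = real (n - i) - real n / 2" "n - i \<le> n" by (auto simp: of_nat_diff)
  then show ?thesis unfolding l idx_half_nat by (metis atMost_iff image_eqI)
qed

lemma bij_betw_uminus_idx: "l \<in> half_nats \<Longrightarrow> bij_betw uminus (idx l) (idx l)"
  by (rule bij_betw_byWitness[where f' = uminus]) (auto intro: idx_uminus)

lemma top_in_idx: "l \<in> half_nats \<Longrightarrow> l \<in> idx l"
proof (elim half_nats_cases)
  fix n assume l: "l = real n / 2"
  show "l \<in> idx l" unfolding l idx_half_nat by (rule image_eqI[of _ _ n]) auto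
qed

section \<open>The monomials \<open>psi\<close> and the existence of the Wigner functions\<close>

lemma floor_half: "\<lfloor>real n / 2 + (real i - real n / 2)\<rfloor> = int i"
  "i \<le> n \<Longrightarrow> \<lfloor>real n / 2 - (real i - real n / 2)\<rfloor> = int (n - i)"
  "\<lfloor>2 * (real n / 2)\<rfloor> = int n"
  by (simp_all add: floor_eq_iff of_nat_diff)

lemma psi_half_nat:
  assumes "i \<le> n"
  shows "psi (real n / 2) (real i - real n / 2) z0 z1
       = complex_of_real (sqrt (real (n choose i))) * z0 ^ i * z1 ^ (n - i)"
  unfolding psi_def floor_half floor_half(2)[OF assms] nat_int ..

text \<open>For \<open>z1 = 1\<close> both sides are polynomials in \<open>z0\<close>, and each
  index contributes a different power with a non-zero factor, so coefficients can be
  compared.\<close>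

lemma psi_independent:
  assumes l: "l \<in> half_nats"
    and eq: "\<And>z0 z1. (\<Sum>k\<in>idx l. psi l k z0 z1 * d k) = (\<Sum>k\<in>idx l. psi l k z0 z1 * e k)"
    and k: "k \<in> idx l"
  shows "d k = e k"
proof -
  from l obtain n where n: "l = real n / 2" by (rule half_nats_cases)
  from k obtain i where i: "i \<le> n" "k = real i - real n / 2"
    unfolding n by (rule idx_half_nat_cases)
  let ?c = "\<lambda>i. complex_of_real (sqrt (real (n choose i)))"
  have "(\<Sum>i\<le>n. (?c i * d (real i - real n / 2)) * z ^ i)
      = (\<Sum>i\<le>n. (?c i * e (real i - real n / 2)) * z ^ i)" for z
    using eq[of z 1] by (simp add: n sum_idx_half_nat psi_half_nat mult_ac)
  then have "?c i * d k = ?c i * e k"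
    using polyfun_eq_coeffs[of "\<lambda>i. ?c i * d (real i - real n / 2)" n
        "\<lambda>i. ?c i * e (real i - real n / 2)"] i by blast
  then show ?thesis using i by simp
qed

text \<open>Multiplying by one linear form at a time keeps the expansion homogeneous. With the
  parameter \<open>x\<close>, a single induction yields both the existence and the continuity of the
  Wigner functions.\<close>

lemma linear_forms_expansion:
  fixes a b c d :: "'a::topological_space \<Rightarrow> complex"
  assumes "continuous_on UNIV a" "continuous_on UNIV b" "continuous_on UNIV c" "continuous_on UNIV d"
  shows "\<exists>e. (\<forall>i. continuous_on UNIV (e i)) \<and>
    (\<forall>x z0 z1. (a x * z0 + b x * z1) ^ p * (c x * z0 + d x * z1) ^ q
       = (\<Sum>i\<le>p + q. e i x * z0 ^ i * z1 ^ (p + q - i)))"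
proof -
  have step: "\<exists>e. (\<forall>i. continuous_on UNIV (e i)) \<and>
      (\<forall>x z0 z1. (u x * z0 + v x * z1) * f x z0 z1
         = (\<Sum>i\<le>Suc n. e i x * z0 ^ i * z1 ^ (Suc n - i)))"
    if u: "continuous_on UNIV u" and v: "continuous_on UNIV v"
      and f: "\<exists>e. (\<forall>i. continuous_on UNIV (e i)) \<and>
        (\<forall>x z0 z1. f x z0 z1 = (\<Sum>i\<le>n. e i x * z0 ^ i * z1 ^ (n - i)))"
    for u v and f :: "'a \<Rightarrow> complex \<Rightarrow> complex \<Rightarrow> complex" and n
  proof -
    from f obtain e where e: "\<And>i. continuous_on UNIV (e i)"
      "\<And>x z0 z1. f x z0 z1 = (\<Sum>i\<le>n. e i x * z0 ^ i * z1 ^ (n - i))" by blast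
    \<comment> \<open>The coefficient of \<open>z0 ^ i\<close> collects \<open>u\<close> times the
      preceding one and \<open>v\<close> times the one at \<open>i\<close>. Both ends are guarded:
      \<open>i - 1\<close> is truncated at 0, and \<open>e (Suc n)\<close> is arbitrary.\<close>
    define e' where "e' i = (\<lambda>x. (if i = 0 then 0 else u x * e (i - 1) x)
      + (if i = Suc n then 0 else v x * e i x))" for i
    have "(u x * z0 + v x * z1) * f x z0 z1
       = (\<Sum>i\<le>Suc n. e' i x * z0 ^ i * z1 ^ (Suc n - i))" for x z0 z1
    proof -
      have "(\<Sum>i\<le>Suc n. e' i x * z0 ^ i * z1 ^ (Suc n - i))
        = (\<Sum>i\<le>Suc n. (if i = 0 then 0 else u x * e (i - 1) x) * z0 ^ i * z1 ^ (Suc n - i))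
        + (\<Sum>i\<le>Suc n. (if i = Suc n then 0 else v x * e i x) * z0 ^ i * z1 ^ (Suc n - i))"
        by (simp add: e'_def algebra_simps sum.distrib del: sum.atMost_Suc)
      also have "(\<Sum>i\<le>Suc n. (if i = 0 then 0 else u x * e (i - 1) x) * z0 ^ i * z1 ^ (Suc n - i))
        = u x * z0 * f x z0 z1"
        by (subst sum.atMost_Suc_shift) (simp add: e sum_distrib_left mult_ac)
      also have "(\<Sum>i\<le>Suc n. (if i = Suc n then 0 else v x * e i x) * z0 ^ i * z1 ^ (Suc n - i))
        = v x * z1 * f x z0 z1"
        by (simp add: e sum_distrib_left) (intro sum.cong, auto simp: Suc_diff_le mult_ac)
      finally show ?thesis by (simp add: algebra_simps)
    qed
    moreover have "continuous_on UNIV (e' i)" for i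
      unfolding e'_def using u v e(1) by (intro continuous_intros; cases "i = 0"; cases "i = Suc n")
        (auto intro!: continuous_intros)
    ultimately show ?thesis by blast
  qed
  have q: "\<exists>e. (\<forall>i. continuous_on UNIV (e i)) \<and>
      (\<forall>x z0 z1. (c x * z0 + d x * z1) ^ q = (\<Sum>i\<le>q. e i x * z0 ^ i * z1 ^ (q - i)))"
  proof (induction q)
    case 0
    show ?case by (intro exI[of _ "\<lambda>_ _. 1"]) auto
  next
    case (Suc q)
    from step[OF assms(3,4) this] show ?case by simp
  qed
  show ?thesis
  proof (induction p)
    case 0
    with q show ?case by simp
  next
    case (Suc p)
    from step[OF assms(1,2) this] show ?case by (simp add: mult_ac)
  qed
qed

lemma psi_substitution_expansion:
  assumes l: "l \<in> half_nats" and s: "s \<in> idx l"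
  shows "\<exists>e. (\<forall>k. continuous_on UNIV (e k)) \<and>
    (\<forall>g z0 z1. psi l s (cnj (g $ 1 $ 1) * z0 + cnj (g $ 2 $ 1) * z1)
                       (- (g $ 2 $ 1) * z0 + g $ 1 $ 1 * z1)
       = (\<Sum>k\<in>idx l. psi l k z0 z1 * e k (g :: complex^2^2)))"
proof -
  from l obtain n where n: "l = real n / 2" by (rule half_nats_cases)
  from s obtain j where j: "j \<le> n" "s = real j - real n / 2"
    unfolding n by (rule idx_half_nat_cases)
  have "\<exists>e. (\<forall>i. continuous_on UNIV (e i)) \<and>
    (\<forall>g z0 z1. (cnj (g $ 1 $ 1) * z0 + cnj (g $ 2 $ 1) * z1) ^ j
        * (- (g $ 2 $ 1) * z0 + g $ 1 $ 1 * z1) ^ (n - j)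
       = (\<Sum>i\<le>j + (n - j). e i (g :: complex^2^2) * z0 ^ i * z1 ^ (j + (n - j) - i)))"
    by (rule linear_forms_expansion) (intro continuous_intros)+
  then obtain e where e: "\<And>i. continuous_on UNIV (e i)" and e_eq:
    "\<And>g z0 z1. (cnj (g $ 1 $ 1) * z0 + cnj (g $ 2 $ 1) * z1) ^ j
        * (- (g $ 2 $ 1) * z0 + g $ 1 $ 1 * z1) ^ (n - j)
       = (\<Sum>i\<le>n. e i (g :: complex^2^2) * z0 ^ i * z1 ^ (n - i))"
    using j(1) by auto
  let ?c = "\<lambda>i. complex_of_real (sqrt (real (n choose i)))"
  \<comment> \<open>Division by the root of the binomial undoes the normalisation of
    \<open>psi l k\<close>; \<open>nat \<lfloor>l + k\<rfloor>\<close> is the exponent of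
    \<open>z0\<close> in it.\<close>
  define E where "E k g = ?c j / ?c (nat \<lfloor>l + k\<rfloor>) * e (nat \<lfloor>l + k\<rfloor>) g" for k g
  have "psi l s (cnj (g $ 1 $ 1) * z0 + cnj (g $ 2 $ 1) * z1)
                       (- (g $ 2 $ 1) * z0 + g $ 1 $ 1 * z1)
       = (\<Sum>k\<in>idx l. psi l k z0 z1 * E k g)" for g z0 z1
  proof -
    have "psi l s (cnj (g $ 1 $ 1) * z0 + cnj (g $ 2 $ 1) * z1)
                       (- (g $ 2 $ 1) * z0 + g $ 1 $ 1 * z1)
      = ?c j * (\<Sum>i\<le>n. e i g * z0 ^ i * z1 ^ (n - i))"
      by (simp only: n j(2) psi_half_nat[OF j(1)] e_eq mult.assoc)
    also have "\<dots> = (\<Sum>k\<in>idx l. psi l k z0 z1 * E k g)"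
      unfolding n sum_idx_half_nat sum_distrib_left
      by (intro sum.cong) (simp_all add: psi_half_nat E_def n floor_half mult_ac)
    finally show ?thesis .
  qed
  moreover have "continuous_on UNIV (E k)" for k
    unfolding E_def by (intro continuous_intros e)
  ultimately show ?thesis by blast
qed

text \<open>Justifies the definite description: an expansion exists, it is unique on
  \<open>idx l\<close> by \<open>psi_independent\<close>, and the value 0 elsewhere fixes the whole
  function.\<close>

lemma wigner_D_sum:
  assumes l: "l \<in> half_nats" and s: "s \<in> idx l"
  shows "(\<Sum>k\<in>idx l. psi l k z0 z1 * wigner_D l k s g) =
           psi l s (cnj (g $ 1 $ 1) * z0 + cnj (g $ 2 $ 1) * z1)
                   (- (g $ 2 $ 1) * z0 + g $ 1 $ 1 * z1)"
proof -
  let ?P = "\<lambda>d :: real \<Rightarrow> complex. (\<forall>k. k \<notin> idx l \<longrightarrow> d k = 0) \<and>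
        (\<forall>z0 z1. (\<Sum>k\<in>idx l. psi l k z0 z1 * d k) =
           psi l s (cnj (g $ 1 $ 1) * z0 + cnj (g $ 2 $ 1) * z1)
                   (- (g $ 2 $ 1) * z0 + g $ 1 $ 1 * z1))"
  from psi_substitution_expansion[OF assms] obtain e where
    e: "\<And>z0 z1. psi l s (cnj (g $ 1 $ 1) * z0 + cnj (g $ 2 $ 1) * z1)
                       (- (g $ 2 $ 1) * z0 + g $ 1 $ 1 * z1)
       = (\<Sum>k\<in>idx l. psi l k z0 z1 * e k g)" by blast
  have ex: "?P (\<lambda>k. if k \<in> idx l then e k g else 0)"
    using e by auto
  have "?P (THE d. ?P d)"
  proof (rule theI[of ?P, OF ex])
    fix d assume d: "?P d"
    have "d k = e k g" if "k \<in> idx l" for k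
      by (rule psi_independent[OF l _ that]) (use d e in auto)
    with d show "d = (\<lambda>k. if k \<in> idx l then e k g else 0)" by auto
  qed
  moreover have "(\<lambda>k. wigner_D l k s g) = (THE d. ?P d)"
    unfolding wigner_D_def by simp
  ultimately show ?thesis by metis
qed

lemma wigner_D_eqI:
  assumes l: "l \<in> half_nats" and s: "s \<in> idx l" and m: "m \<in> idx l"
    and "\<And>z0 z1. (\<Sum>k\<in>idx l. psi l k z0 z1 * d k) =
           psi l s (cnj (g $ 1 $ 1) * z0 + cnj (g $ 2 $ 1) * z1)
                   (- (g $ 2 $ 1) * z0 + g $ 1 $ 1 * z1)"
  shows "wigner_D l m s g = d m"
  by (rule psi_independent[OF l _ m]) (simp only: wigner_D_sum[OF l s] assms(4))

lemma continuous_on_wigner_D: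
  assumes l: "l \<in> half_nats" and s: "s \<in> idx l" and m: "m \<in> idx l"
  shows "continuous_on UNIV (wigner_D l m s)"
proof -
  from psi_substitution_expansion[OF l s] obtain e where
    c: "continuous_on UNIV (e m)" and
    e: "\<And>(g :: complex^2^2) z0 z1. psi l s (cnj (g $ 1 $ 1) * z0 + cnj (g $ 2 $ 1) * z1)
                       (- (g $ 2 $ 1) * z0 + g $ 1 $ 1 * z1)
       = (\<Sum>k\<in>idx l. psi l k z0 z1 * e k g)" by blast
  have "wigner_D l m s = e m"
    by (intro ext wigner_D_eqI[OF l s m]) (simp only: e)
  with c show ?thesis by simp
qed

section \<open>The group SU(2) and its unitary Wigner matrices\<close>

lemma SU2_mat_nth:
  "SU2_mat a b $ 1 $ 1 = a" "SU2_mat a b $ 1 $ 2 = - cnj b"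
  "SU2_mat a b $ 2 $ 1 = b" "SU2_mat a b $ 2 $ 2 = cnj a"
  by (simp_all add: SU2_mat_def)

lemma SU2_mat_mult: "SU2_mat a b ** SU2_mat c d = SU2_mat (a * c - cnj b * d) (b * c + cnj a * d)"
  by (simp add: SU2_mat_def vec_eq_iff forall_2 matrix_matrix_mult_def sum_2)

lemma cmod_squares_eq: "(cmod a)\<^sup>2 + (cmod b)\<^sup>2 = 1 \<longleftrightarrow> a * cnj a + b * cnj b = 1"
  by (simp add: complex_norm_square[symmetric] flip: of_real_add of_real_power)

lemma SU2_E:
  assumes "g \<in> SU2"
  obtains a b where "g = SU2_mat a b" "a * cnj a + b * cnj b = 1"
  using assms by (auto simp: SU2_def cmod_squares_eq)

lemma SU2_I: "a * cnj a + b * cnj b = 1 \<Longrightarrow> SU2_mat a b \<in> SU2"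
  by (auto simp: SU2_def cmod_squares_eq)

lemma SU2_mult:
  assumes "g \<in> SU2" "h \<in> SU2" shows "g ** h \<in> SU2"
proof -
  from assms obtain a b c d where g: "g = SU2_mat a b" and ab: "a * cnj a + b * cnj b = 1"
    and h: "h = SU2_mat c d" and cd: "c * cnj c + d * cnj d = 1"
    by (metis SU2_E)
  have "(a * c - cnj b * d) * cnj (a * c - cnj b * d) + (b * c + cnj a * d) * cnj (b * c + cnj a * d)
    = (a * cnj a + b * cnj b) * (c * cnj c + d * cnj d)"
    by (simp add: algebra_simps)
  then show ?thesis unfolding g h SU2_mat_mult by (intro SU2_I) (simp only: ab cd mult_1)
qed

lemma SU2_mat_1_0: "SU2_mat 1 0 = mat 1"
  by (simp add: SU2_mat_def vec_eq_iff forall_2 mat_def)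

lemma mat_1_in_SU2: "mat 1 \<in> SU2"
  using SU2_I[of 1 0] by (simp add: SU2_mat_1_0)

text \<open>The variables are transformed by the inverse of \<open>h\<close>, then by that of
  \<open>g\<close>, hence by the inverse of \<open>h ** g\<close>. The defining identity reads only
  the first column of a matrix, so the second one has to be determined by it, as it is in
  \<open>SU2\<close>.\<close>

lemma wigner_D_mult:
  assumes l: "l \<in> half_nats" and s: "s \<in> idx l" and m: "m \<in> idx l"
    and h: "h \<in> SU2" and g: "g \<in> SU2"
  shows "wigner_D l m s (h ** g) = (\<Sum>k\<in>idx l. wigner_D l m k h * wigner_D l k s g)"
proof (rule wigner_D_eqI[OF l s m])
  fix z0 z1
  from h g obtain a b c d where h: "h = SU2_mat a b" and g: "g = SU2_mat c d"
    by (metis SU2_E)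
  let ?w0 = "cnj (h $ 1 $ 1) * z0 + cnj (h $ 2 $ 1) * z1"
  let ?w1 = "- (h $ 2 $ 1) * z0 + h $ 1 $ 1 * z1"
  have "(\<Sum>k\<in>idx l. psi l k z0 z1 * (\<Sum>j\<in>idx l. wigner_D l k j h * wigner_D l j s g))
    = (\<Sum>j\<in>idx l. (\<Sum>k\<in>idx l. psi l k z0 z1 * wigner_D l k j h) * wigner_D l j s g)"
    unfolding sum_distrib_left sum_distrib_right by (subst sum.swap) (simp add: mult_ac)
  also have "\<dots> = (\<Sum>j\<in>idx l. psi l j ?w0 ?w1 * wigner_D l j s g)"
    by (intro sum.cong refl) (simp only: wigner_D_sum[OF l])
  also have "\<dots> = psi l s (cnj (g $ 1 $ 1) * ?w0 + cnj (g $ 2 $ 1) * ?w1)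
                   (- (g $ 2 $ 1) * ?w0 + g $ 1 $ 1 * ?w1)"
    by (rule wigner_D_sum[OF l s])
  also have "\<dots> = psi l s (cnj ((h ** g) $ 1 $ 1) * z0 + cnj ((h ** g) $ 2 $ 1) * z1)
                   (- ((h ** g) $ 2 $ 1) * z0 + (h ** g) $ 1 $ 1 * z1)"
    by (intro arg_cong2[where f = "psi l s"])
       (simp_all add: h g SU2_mat_mult SU2_mat_nth algebra_simps)
  finally show "(\<Sum>k\<in>idx l. psi l k z0 z1 * (\<Sum>j\<in>idx l. wigner_D l k j h * wigner_D l j s g))
    = \<dots>" .
qed

text \<open>The substitution only rescales \<open>z0\<close> by \<open>cnj a\<close> and
  \<open>z1\<close> by \<open>a\<close>, so every \<open>psi l s\<close> is an eigenvector.\<close>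

lemma wigner_D_diagonal:
  assumes l: "l \<in> half_nats" and s: "s \<in> idx l" and m: "m \<in> idx l"
  shows "wigner_D l m s (SU2_mat a 0) = of_bool (m = s) * (cnj a ^ nat \<lfloor>l + s\<rfloor> * a ^ nat \<lfloor>l - s\<rfloor>)"
proof (rule wigner_D_eqI[OF l s m])
  fix z0 z1
  have "(\<Sum>k\<in>idx l. psi l k z0 z1 * (of_bool (k = s) * (cnj a ^ nat \<lfloor>l + s\<rfloor> * a ^ nat \<lfloor>l - s\<rfloor>)))
    = (\<Sum>k\<in>idx l. if k = s then psi l k z0 z1 * (cnj a ^ nat \<lfloor>l + s\<rfloor> * a ^ nat \<lfloor>l - s\<rfloor>) else 0)"
    by (intro sum.cong) auto
  also have "\<dots> = psi l s z0 z1 * (cnj a ^ nat \<lfloor>l + s\<rfloor> * a ^ nat \<lfloor>l - s\<rfloor>)"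
    using s finite_idx[OF l] by simp
  finally show "(\<Sum>k\<in>idx l. psi l k z0 z1 * (of_bool (k = s) * (cnj a ^ nat \<lfloor>l + s\<rfloor> * a ^ nat \<lfloor>l - s\<rfloor>)))
    = psi l s (cnj (SU2_mat a 0 $ 1 $ 1) * z0 + cnj (SU2_mat a 0 $ 2 $ 1) * z1)
                   (- (SU2_mat a 0 $ 2 $ 1) * z0 + SU2_mat a 0 $ 1 $ 1 * z1)"
    by (simp add: SU2_mat_nth psi_def power_mult_distrib mult_ac)
qed

lemma wigner_D_one:
  assumes "l \<in> half_nats" "s \<in> idx l" "m \<in> idx l"
  shows "wigner_D l m s (mat 1) = of_bool (m = s)"
  using wigner_D_diagonal[OF assms, of 1] by (simp add: SU2_mat_1_0)

text \<open>Evaluation of the defining identity at \<open>(z0, z1) = (1, 0)\<close>.\<close>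

lemma wigner_D_top_row:
  assumes l: "l \<in> half_nats" and s: "s \<in> idx l"
  shows "wigner_D l l s g = psi l s (cnj (g $ 1 $ 1)) (- (g $ 2 $ 1))"
proof -
  from l obtain n where n: "l = real n / 2" by (rule half_nats_cases)
  have "psi l s (cnj (g $ 1 $ 1)) (- (g $ 2 $ 1)) = (\<Sum>k\<in>idx l. psi l k 1 0 * wigner_D l k s g)"
    using wigner_D_sum[OF l s, of 1 0 g] by simp
  also have "\<dots> = (\<Sum>i\<le>n. if i = n then wigner_D l (real n - real n / 2) s g else 0)"
    unfolding n sum_idx_half_nat by (intro sum.cong) (auto simp: psi_half_nat)
  also have "\<dots> = wigner_D l l s g" by (simp add: n)
  finally show ?thesis by simp
qed

text \<open>The entries of the top row are single monomials in the matrix entries, so nothing can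
  cancel.\<close>

lemma wigner_D_top_row_nonzero:
  assumes l: "l \<in> half_nats" and s: "s \<in> idx l" and "a \<noteq> 0" "b \<noteq> 0"
  shows "wigner_D l l s (SU2_mat a b) \<noteq> 0"
proof -
  from l obtain n where n: "l = real n / 2" by (rule half_nats_cases)
  from s obtain i where i: "i \<le> n" "s = real i - real n / 2"
    unfolding n by (rule idx_half_nat_cases)
  show ?thesis unfolding wigner_D_top_row[OF l s] using assms(3,4) i
    by (simp add: SU2_mat_nth n psi_half_nat)
qed

text \<open>The binomial theorem: the square roots in the two factors multiply to the full binomial
  coefficient.\<close>

lemma psi_reproducing:
  assumes l: "l \<in> half_nats"
  shows "(\<Sum>k\<in>idx l. psi l k z0 z1 * cnj (psi l k w0 w1))
    = (z0 * cnj w0 + z1 * cnj w1) ^ nat \<lfloor>2 * l\<rfloor>"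
proof -
  from l obtain n where n: "l = real n / 2" by (rule half_nats_cases)
  have sq: "complex_of_real (sqrt (real N)) * complex_of_real (sqrt (real N)) = of_nat N" for N
    by (simp flip: of_real_mult)
  show ?thesis
    unfolding n sum_idx_half_nat binomial_ring floor_half nat_int
  proof (intro sum.cong refl)
    fix i assume "i \<in> {..n}"
    then have i: "i \<le> n" by simp
    have "psi (real n / 2) (real i - real n / 2) z0 z1 * cnj (psi (real n / 2) (real i - real n / 2) w0 w1)
      = (complex_of_real (sqrt (real (n choose i))) * complex_of_real (sqrt (real (n choose i))))
        * (z0 * cnj w0) ^ i * (z1 * cnj w1) ^ (n - i)"
      by (simp only: psi_half_nat[OF i] complex_cnj_mult complex_cnj_power complex_cnj_complex_of_real
          power_mult_distrib mult_ac)
    then show "psi (real n / 2) (real i - real n / 2) z0 z1 * cnj (psi (real n / 2) (real i - real n / 2) w0 w1)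
      = of_nat (n choose i) * (z0 * cnj w0) ^ i * (z1 * cnj w1) ^ (n - i)"
      by (simp only: sq)
  qed
qed

text \<open>
  The adjoint formula expresses that the kernel \<open>(z, w) \<mapsto> (z0 * cnj w0 + z1 * cnj w1) ^ (2 * l)\<close>,
  which equals \<open>\<Sum>k. psi l k z * cnj (psi l k w)\<close>, takes the substitution by \<open>g\<close> in \<open>z\<close>
  to the substitution by \<open>g\<inverse>\<close> in \<open>w\<close>.
\<close>

lemma wigner_D_adjoint:
  assumes l: "l \<in> half_nats" and s: "s \<in> idx l" and m: "m \<in> idx l"
  shows "wigner_D l m s (SU2_mat a b) = cnj (wigner_D l s m (SU2_mat (cnj a) (- b)))"
proof -
  let ?g = "SU2_mat a b" and ?h = "SU2_mat (cnj a) (- b)"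
  have eq: "(\<Sum>k\<in>idx l. psi l k z0 z1 * (\<Sum>j\<in>idx l. wigner_D l k j ?g * cnj (psi l j w0 w1)))
    = (\<Sum>k\<in>idx l. psi l k z0 z1 * (\<Sum>j\<in>idx l. cnj (wigner_D l j k ?h) * cnj (psi l j w0 w1)))"
    for z0 z1 w0 w1
  proof -
    let ?u0 = "cnj a * z0 + cnj b * z1" and ?u1 = "- b * z0 + a * z1"
    let ?v0 = "a * w0 - cnj b * w1" and ?v1 = "b * w0 + cnj a * w1"
    have "(\<Sum>k\<in>idx l. psi l k z0 z1 * (\<Sum>j\<in>idx l. wigner_D l k j ?g * cnj (psi l j w0 w1)))
      = (\<Sum>j\<in>idx l. (\<Sum>k\<in>idx l. psi l k z0 z1 * wigner_D l k j ?g) * cnj (psi l j w0 w1))"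
      unfolding sum_distrib_left sum_distrib_right by (subst sum.swap) (simp add: mult_ac)
    also have "\<dots> = (\<Sum>j\<in>idx l. psi l j ?u0 ?u1 * cnj (psi l j w0 w1))"
      by (intro sum.cong refl) (simp add: wigner_D_sum[OF l] SU2_mat_nth)
    also have "\<dots> = (z0 * cnj ?v0 + z1 * cnj ?v1) ^ nat \<lfloor>2 * l\<rfloor>"
      unfolding psi_reproducing[OF l] by (rule arg_cong2[where f = "(^)"]) (simp_all add: algebra_simps)
    also have "\<dots> = (\<Sum>k\<in>idx l. psi l k z0 z1 * cnj (psi l k ?v0 ?v1))"
      by (rule psi_reproducing[OF l, symmetric])
    also have "\<dots> = (\<Sum>k\<in>idx l. psi l k z0 z1 * cnj (\<Sum>j\<in>idx l. psi l j w0 w1 * wigner_D l j k ?h))"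
      by (intro sum.cong refl) (simp add: wigner_D_sum[OF l] SU2_mat_nth)
    finally show ?thesis by (simp add: mult_ac)
  qed
  have "(\<Sum>j\<in>idx l. wigner_D l m j ?g * cnj (psi l j w0 w1))
    = (\<Sum>j\<in>idx l. cnj (wigner_D l j m ?h) * cnj (psi l j w0 w1))" for w0 w1
    by (rule psi_independent[OF l eq m])
  \<comment> \<open>Conjugation turns \<open>cnj (psi l j w0 w1)\<close> into
    \<open>psi l j w0 w1\<close>, so that coefficients can be compared a second time, now in
    \<open>w0\<close> and \<open>w1\<close>.\<close>
  then have "cnj (\<Sum>j\<in>idx l. wigner_D l m j ?g * cnj (psi l j w0 w1))
    = cnj (\<Sum>j\<in>idx l. cnj (wigner_D l j m ?h) * cnj (psi l j w0 w1))" for w0 w1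
    by (simp only:)
  then have "cnj (wigner_D l m s ?g) = wigner_D l s m ?h"
    by (intro psi_independent[where d = "\<lambda>j. cnj (wigner_D l m j ?g)"
          and e = "\<lambda>j. wigner_D l j m ?h", OF l _ s]) (simp add: mult_ac)
  then show ?thesis by (metis complex_cnj_cnj)
qed

text \<open>By \<open>wigner_D_adjoint\<close> the conjugate transpose of the matrix at
  \<open>g\<close> is the matrix at the inverse of \<open>g\<close>; their product is the matrix at
  the identity.\<close>

lemma wigner_D_unitary:
  assumes l: "l \<in> half_nats" and s: "s \<in> idx l" and m: "m \<in> idx l" and g: "g \<in> SU2"
  shows "(\<Sum>k\<in>idx l. cnj (wigner_D l k m g) * wigner_D l k s g) = of_bool (m = s)"
proof -
  from g obtain a b where ab: "g = SU2_mat a b" "a * cnj a + b * cnj b = 1" by (rule SU2_E)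
  let ?h = "SU2_mat (cnj a) (- b)"
  have h: "?h \<in> SU2" using ab by (intro SU2_I) (simp add: mult_ac)
  have "?h ** g = mat 1"
    using ab by (simp add: SU2_mat_mult mult_ac flip: SU2_mat_1_0)
  have "(\<Sum>k\<in>idx l. cnj (wigner_D l k m g) * wigner_D l k s g)
    = (\<Sum>k\<in>idx l. wigner_D l m k ?h * wigner_D l k s g)"
    by (intro sum.cong refl) (simp add: ab wigner_D_adjoint[OF l m])
  also have "\<dots> = of_bool (m = s)"
    by (simp only: wigner_D_mult[OF l s m h g, symmetric] \<open>?h ** g = mat 1\<close> wigner_D_one[OF l s m])
  finally show ?thesis .
qed

section \<open>Complex conjugation of the Wigner matrices\<close>

lemma psi_swap: "psi l (- k) z0 z1 = psi l k z1 z0" if "l \<in> half_nats" "k \<in> idx l"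
proof -
  from that(1) obtain n where n: "l = real n / 2" by (rule half_nats_cases)
  from that(2) obtain i where i: "i \<le> n" "k = real i - real n / 2"
    unfolding n by (rule idx_half_nat_cases)
  have k: "- k = real (n - i) - real n / 2" using i by (simp add: of_nat_diff)
  have "psi l (- k) z0 z1 = psi (real n / 2) (real (n - i) - real n / 2) z0 z1" by (simp only: k n)
  also have "\<dots> = psi (real n / 2) (real i - real n / 2) z1 z0"
    using i(1) by (simp add: psi_half_nat binomial_symmetric[symmetric] del: of_nat_diff)
  finally show ?thesis by (simp add: n i)
qed

lemma psi_neg_right: "psi l k z0 (- z1) = (- 1) ^ nat \<lfloor>l - k\<rfloor> * psi l k z0 z1"
  unfolding psi_def by (subst power_minus) (simp add: mult_ac)

lemma cnj_psi: "cnj (psi l k z0 z1) = psi l k (cnj z0) (cnj z1)"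
  by (simp add: psi_def)

text \<open>The map \<open>(w0, w1) \<mapsto> (- w1, w0)\<close> intertwines the conjugated
  substitution with the substitution itself. On \<open>psi\<close> it negates the index up to a
  sign, which accounts for the two signs.\<close>

lemma cnj_wigner_D:
  assumes l: "l \<in> half_nats" and s: "s \<in> idx l" and m: "m \<in> idx l"
  shows "cnj (wigner_D l m s g)
    = (- 1) ^ nat \<lfloor>l - m\<rfloor> * (- 1) ^ nat \<lfloor>l - s\<rfloor> * wigner_D l (- m) (- s) g"
proof (rule psi_independent[OF l _ m])
  fix w0 w1
  let ?a = "g $ 1 $ 1" and ?b = "g $ 2 $ 1"
  have "(\<Sum>k\<in>idx l. psi l k w0 w1 * cnj (wigner_D l k s g))
    = cnj (\<Sum>k\<in>idx l. psi l k (cnj w0) (cnj w1) * wigner_D l k s g)"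
    by (simp add: cnj_psi)
  also have "\<dots> = psi l s (?a * w0 + ?b * w1) (- (cnj ?b * w0 - cnj ?a * w1))"
    unfolding wigner_D_sum[OF l s] cnj_psi
    by (intro arg_cong2[where f = "psi l s"]) (simp_all add: algebra_simps)
  also have "\<dots> = (- 1) ^ nat \<lfloor>l - s\<rfloor> * psi l (- s) (cnj ?b * w0 - cnj ?a * w1) (?a * w0 + ?b * w1)"
    by (simp only: psi_neg_right psi_swap[OF l s])
  also have "psi l (- s) (cnj ?b * w0 - cnj ?a * w1) (?a * w0 + ?b * w1)
    = (\<Sum>k\<in>idx l. psi l k (- w1) w0 * wigner_D l k (- s) g)"
    by (simp add: wigner_D_sum[OF l idx_uminus[OF l s]] algebra_simps)
  also have "\<dots> = (\<Sum>k\<in>idx l. psi l (- k) (- w1) w0 * wigner_D l (- k) (- s) g)"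
    by (rule sum.reindex_bij_betw[OF bij_betw_uminus_idx[OF l], symmetric])
  also have "\<dots> = (\<Sum>k\<in>idx l. psi l k w0 w1 * ((- 1) ^ nat \<lfloor>l - k\<rfloor> * wigner_D l (- k) (- s) g))"
    by (intro sum.cong refl) (simp add: psi_swap[OF l] psi_neg_right mult_ac)
  finally show "(\<Sum>k\<in>idx l. psi l k w0 w1 * cnj (wigner_D l k s g))
    = (\<Sum>k\<in>idx l. psi l k w0 w1 * ((- 1) ^ nat \<lfloor>l - k\<rfloor> * (- 1) ^ nat \<lfloor>l - s\<rfloor> * wigner_D l (- k) (- s) g))"
    by (simp add: sum_distrib_left mult_ac)
qed


section \<open>Left invariance of the volume\<close>

text \<open>For a fixed second coordinate the shear is a translation of the first, so Tonelli's
  theorem applies slice by slice.\<close>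

lemma lborel_distr_shear_fst:
  fixes c :: complex
  shows "distr lborel lborel (\<lambda>z :: complex \<times> complex. (fst z + c * snd z, snd z)) = lborel"
proof (rule measure_eqI)
  let ?T = "\<lambda>z :: complex \<times> complex. (fst z + c * snd z, snd z)"
  have T: "?T \<in> measurable lborel lborel"
    unfolding measurable_lborel1 measurable_lborel2
    by (intro borel_measurable_continuous_onI continuous_intros)
  fix A :: "(complex \<times> complex) set" assume "A \<in> sets (distr lborel lborel ?T)"
  then have A: "A \<in> sets lborel" by simp
  then have A': "A \<in> sets (lborel \<Otimes>\<^sub>M lborel)" by (simp only: lborel_prod)
  have TA: "?T -` A \<in> sets (lborel \<Otimes>\<^sub>M lborel)"
    using measurable_sets[OF T A] by (simp only: lborel_prod space_lborel space_borel Int_UNIV_right)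
  have "emeasure (distr lborel lborel ?T) A = emeasure (lborel \<Otimes>\<^sub>M lborel) (?T -` A)"
    using T A by (simp add: emeasure_distr lborel_prod)
  also have "\<dots> = (\<integral>\<^sup>+w. emeasure lborel ((\<lambda>z. (z, w)) -` (?T -` A)) \<partial>lborel)"
    by (rule lborel_pair.emeasure_pair_measure_alt2[OF TA])
  also have "\<dots> = (\<integral>\<^sup>+w. emeasure lborel ((\<lambda>z. (z, w)) -` A) \<partial>lborel)"
  proof (intro nn_integral_cong)
    fix w :: complex
    have sec: "(\<lambda>z. (z, w)) -` A \<in> sets borel"
      using sets_Pair2[OF A', of w] by simp
    have "emeasure lborel ((\<lambda>z. (z, w)) -` (?T -` A))
      = emeasure lborel ((+) (c * w) -` ((\<lambda>z. (z, w)) -` A) \<inter> space lborel)"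
      by (intro arg_cong2[where f = emeasure]) (auto simp: add.commute)
    also have "\<dots> = emeasure (distr lborel borel ((+) (c * w))) ((\<lambda>z. (z, w)) -` A)"
      using sec by (subst emeasure_distr) auto
    finally show "emeasure lborel ((\<lambda>z. (z, w)) -` (?T -` A)) = emeasure lborel ((\<lambda>z. (z, w)) -` A)"
      by (simp add: lborel_distr_plus)
  qed
  also have "\<dots> = emeasure (lborel \<Otimes>\<^sub>M lborel) A"
    by (rule lborel_pair.emeasure_pair_measure_alt2[OF A', symmetric])
  finally show "emeasure (distr lborel lborel ?T) A = emeasure lborel A" by (simp add: lborel_prod)
qed simp

text \<open>Conjugate the other shear by the exchange of the two coordinates.\<close>

lemma lborel_distr_shear_snd:
  fixes c :: complex
  shows "distr lborel lborel (\<lambda>z :: complex \<times> complex. (fst z, snd z + c * fst z)) = lborel"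
proof -
  let ?s = "\<lambda>z :: complex \<times> complex. (snd z, fst z)"
  let ?T = "\<lambda>z :: complex \<times> complex. (fst z + c * snd z, snd z)"
  have s: "?s \<in> measurable lborel lborel"
    unfolding measurable_lborel1 measurable_lborel2
    by (intro borel_measurable_continuous_onI continuous_intros)
  have T: "?T \<in> measurable lborel lborel"
    unfolding measurable_lborel1 measurable_lborel2
    by (intro borel_measurable_continuous_onI continuous_intros)
  have swap: "distr lborel lborel ?s = lborel"
  proof -
    have "distr (lborel \<Otimes>\<^sub>M lborel) (lborel \<Otimes>\<^sub>M lborel) (\<lambda>(x, y). (y, x)) = (lborel \<Otimes>\<^sub>M lborel :: (complex \<times> complex) measure)"
      by (rule lborel_pair.distr_pair_swap[symmetric])
    then show ?thesis by (simp add: lborel_prod case_prod_unfold)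
  qed
  have "distr lborel lborel (\<lambda>z :: complex \<times> complex. (fst z, snd z + c * fst z))
     = distr lborel lborel (?s \<circ> (?T \<circ> ?s))"
    by (simp add: comp_def)
  also have "\<dots> = distr (distr (distr lborel lborel ?s) lborel ?T) lborel ?s"
    by (simp only: distr_distr[OF T s] distr_distr[OF s measurable_comp[OF s T]])
  also have "\<dots> = lborel" by (simp only: swap lborel_distr_shear_fst)
  finally show ?thesis .
qed

text \<open>
  A matrix of determinant 1 with lower left entry \<open>b \<noteq> 0\<close> is the product of the shears
  with parameters \<open>(a - 1) / b\<close>, \<open>b\<close>, \<open>(cnj a - 1) / b\<close>; a diagonal one is the product of
  two matrices with non-zero lower left entries.
\<close>

lemma lborel_distr_SU2_action:
  fixes a b :: complex
  assumes ab: "a * cnj a + b * cnj b = 1"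
  shows "distr lborel lborel (\<lambda>z. (a * fst z - cnj b * snd z, b * fst z + cnj a * snd z)) = lborel"
    (is "distr _ _ (?R a b) = _")
proof -
  have R: "?R a b \<in> measurable lborel lborel" for a b
    unfolding measurable_lborel1 measurable_lborel2
    by (intro borel_measurable_continuous_onI continuous_intros)
  have generic: "distr lborel lborel (?R a b) = lborel"
    if ab: "a * cnj a + b * cnj b = 1" and b: "b \<noteq> 0" for a b :: complex
  proof -
    let ?U = "\<lambda>c z :: complex \<times> complex. (fst z + c * snd z, snd z)"
    let ?L = "\<lambda>c z :: complex \<times> complex. (fst z, snd z + c * fst z)"
    have U: "?U c \<in> measurable lborel lborel" and L: "?L c \<in> measurable lborel lborel" for c
      unfolding measurable_lborel1 measurable_lborel2
      by (intro borel_measurable_continuous_onI continuous_intros)+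
    let ?y = "(cnj a - 1) / b"
    have "?R a b = ?U ((a - 1) / b) \<circ> (?L b \<circ> ?U ?y)"
    proof
      fix z :: "complex \<times> complex"
      \<comment> \<open>The upper right entry of the product of the three shears; the condition
        \<open>ab\<close> that the determinant is 1 enters here.\<close>
      have 1: "- cnj b = ?y + (a - 1) / b * (1 + b * ?y)"
        using ab b by (simp add: field_simps) algebra
      have y: "b * ?y = cnj a - 1" and x: "(a - 1) / b * b = a - 1" using b by auto
      have 2: "b * fst z + cnj a * snd z = snd z + b * (fst z + ?y * snd z)"
        using y by algebra
      have 3: "a * fst z - cnj b * snd z
        = (fst z + ?y * snd z) + (a - 1) / b * (snd z + b * (fst z + ?y * snd z))"
        using 1 x by algebra
      show "?R a b z = (?U ((a - 1) / b) \<circ> (?L b \<circ> ?U ?y)) z"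
        by (simp only: comp_def fst_conv snd_conv 2 3)
    qed
    then have "distr lborel lborel (?R a b)
      = distr (distr (distr lborel lborel (?U ?y)) lborel (?L b)) lborel (?U ((a - 1) / b))"
      by (simp only: distr_distr[OF L U] distr_distr[OF U measurable_comp[OF U L]])
    then show ?thesis by (simp only: lborel_distr_shear_fst lborel_distr_shear_snd)
  qed
  show ?thesis
  proof (cases "b = 0")
    case False
    with ab show ?thesis by (intro generic)
  next
    case True
    with ab have a: "a * cnj a = 1" by simp
    have "?R a b = ?R 0 1 \<circ> ?R 0 (- a)"
      by (auto simp: True fun_eq_iff)
    then have "distr lborel lborel (?R a b) = distr (distr lborel lborel (?R 0 (- a))) lborel (?R 0 1)"
      by (simp only: distr_distr[OF R R])
    moreover have "distr lborel lborel (?R 0 (- a)) = lborel" using a by (intro generic) auto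
    moreover have "distr lborel lborel (?R 0 1) = lborel" by (intro generic) auto
    ultimately show ?thesis by (simp only:)
  qed
qed

section \<open>The volume as a radial image of Lebesgue measure\<close>

lemma space_vol_SU2: "space vol_SU2 = SU2"
  by (simp add: vol_SU2_def space_scale_measure space_restrict_space)

lemma sets_vol_SU2: "sets vol_SU2 = sets (restrict_space borel SU2)"
  by (simp add: vol_SU2_def)

lemma finite_measure_vol_SU2: "finite_measure vol_SU2"
  by (rule finite_measureI) (simp add: emeasure_vol_SU2)

lemma measure_vol_SU2: "measure vol_SU2 SU2 = 16 * pi\<^sup>2"
  using emeasure_vol_SU2 by (simp add: measure_def space_vol_SU2)

lemma SU2_proj_in_SU2:
  fixes z :: "complex \<times> complex"
  assumes "z \<noteq> 0"
  shows "SU2_mat (fst z / norm z) (snd z / norm z) \<in> SU2"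
proof -
  have "(norm z)\<^sup>2 = (cmod (fst z))\<^sup>2 + (cmod (snd z))\<^sup>2" by (simp add: norm_prod_def)
  with assms show ?thesis unfolding SU2_def
    by (auto simp: norm_divide power_divide add_divide_distrib[symmetric] intro!: exI)
qed

lemma measurable_SU2_proj:
  "(\<lambda>z :: complex \<times> complex. SU2_mat (fst z / norm z) (snd z / norm z))
    \<in> measurable (restrict_space lborel (ball 0 2 - {0})) (restrict_space borel SU2)"
  using borel_measurable_SU2_mat_proj SU2_proj_in_SU2
  by (intro measurable_restrict_space2 measurable_restrict_space1)
     (auto simp: space_restrict_space)

text \<open>Passes to the cone over \<open>A\<close>, so that invariance of the volume reduces to
  invariance of Lebesgue measure.\<close>

lemma emeasure_vol_SU2_eq:
  assumes "A \<in> sets vol_SU2"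
  shows "emeasure vol_SU2 A = 2 * emeasure lborel
    {z :: complex \<times> complex. z \<in> ball 0 2 - {0} \<and> SU2_mat (fst z / norm z) (snd z / norm z) \<in> A}"
proof -
  let ?S = "ball 0 2 - {0} :: (complex \<times> complex) set"
  let ?f = "\<lambda>z :: complex \<times> complex. SU2_mat (fst z / norm z) (snd z / norm z)"
  note m = measurable_SU2_proj
  have "emeasure vol_SU2 A = 2 * emeasure (restrict_space lborel ?S) (?f -` A \<inter> ?S)"
    using assms by (simp add: vol_SU2_def emeasure_distr[OF m] space_restrict_space)
  also have "emeasure (restrict_space lborel ?S) (?f -` A \<inter> ?S) = emeasure lborel (?f -` A \<inter> ?S)"
    by (rule emeasure_restrict_space) auto
  also have "?f -` A \<inter> ?S = {z. z \<in> ?S \<and> ?f z \<in> A}" by auto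
  finally show ?thesis .
qed

lemma measurable_SU2_mult:
  assumes "h \<in> SU2"
  shows "(**) h \<in> measurable vol_SU2 vol_SU2"
proof -
  have "continuous_on UNIV ((**) h)"
    unfolding matrix_matrix_mult_def by (intro continuous_intros continuous_on_vec_lambda)
  then have "(**) h \<in> borel_measurable borel" by (rule borel_measurable_continuous_onI)
  then have "(**) h \<in> measurable (restrict_space borel SU2) (restrict_space borel SU2)"
    using SU2_mult[OF assms]
    by (intro measurable_restrict_space2 measurable_restrict_space1) (auto simp: space_restrict_space)
  then show ?thesis by (simp add: measurable_cong_sets[OF sets_vol_SU2 sets_vol_SU2])
qed

text \<open>In the coordinates of the first column, left multiplication by \<open>h\<close> is the
  linear map \<open>?R\<close>. It preserves Lebesgue measure and the norm, hence commutes with the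
  radial projection that defines the volume.\<close>

lemma distr_vol_SU2_mult:
  assumes h: "h \<in> SU2"
  shows "distr vol_SU2 vol_SU2 ((**) h) = vol_SU2"
proof (rule measure_eqI)
  from h obtain a b where ab: "h = SU2_mat a b" "a * cnj a + b * cnj b = 1" by (rule SU2_E)
  let ?R = "\<lambda>z. (a * fst z - cnj b * snd z, b * fst z + cnj a * snd z)"
  let ?f = "\<lambda>z :: complex \<times> complex. SU2_mat (fst z / norm z) (snd z / norm z)"
  let ?S = "ball 0 2 - {0} :: (complex \<times> complex) set"
  have R: "?R \<in> measurable lborel lborel"
    unfolding measurable_lborel1 measurable_lborel2
    by (intro borel_measurable_continuous_onI continuous_intros)
  have norm_R: "norm (?R z) = norm z" for z
  proof -
    have "complex_of_real ((norm (?R z))\<^sup>2) = complex_of_real ((norm z)\<^sup>2)"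
    proof -
      have "complex_of_real ((norm (?R z))\<^sup>2)
        = (a * cnj a + b * cnj b) * (fst z * cnj (fst z) + snd z * cnj (snd z))"
        by (simp add: norm_prod_def complex_norm_square del: of_real_power) (simp add: algebra_simps)
      also have "\<dots> = complex_of_real ((norm z)\<^sup>2)"
        by (simp add: ab norm_prod_def complex_norm_square del: of_real_power)
      finally show ?thesis .
    qed
    then show ?thesis by (simp only: of_real_eq_iff) simp
  qed
  have f_R: "?f (?R z) = h ** ?f z" for z
    by (simp add: norm_R ab SU2_mat_mult diff_divide_distrib add_divide_distrib)
  have mem_R: "?R z \<in> ?S \<longleftrightarrow> z \<in> ?S" for z
    using norm_R[of z] by (metis Diff_iff mem_ball_0 norm_eq_zero singletonD singletonI)
  fix A assume "A \<in> sets (distr vol_SU2 vol_SU2 ((**) h))"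
  then have A: "A \<in> sets vol_SU2" by simp
  let ?B = "{z. z \<in> ?S \<and> ?f z \<in> A}"
  have B: "?B \<in> sets lborel"
  proof -
    from measurable_sets[OF measurable_SU2_proj, of A] A
    have "?f -` A \<inter> ?S \<in> sets (restrict_space lborel ?S)"
      by (simp add: sets_vol_SU2 space_restrict_space)
    then have "?f -` A \<inter> ?S \<in> sets lborel" by (subst (asm) sets_restrict_space_iff) auto
    moreover have "?f -` A \<inter> ?S = ?B" by auto
    ultimately show ?thesis by simp
  qed
  have "emeasure (distr vol_SU2 vol_SU2 ((**) h)) A = emeasure vol_SU2 ((**) h -` A \<inter> SU2)"
    using A by (simp add: emeasure_distr[OF measurable_SU2_mult[OF h]] space_vol_SU2)
  also have "\<dots> = 2 * emeasure lborel {z. z \<in> ?S \<and> ?f z \<in> (**) h -` A \<inter> SU2}"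
    using measurable_sets[OF measurable_SU2_mult[OF h] A]
    by (intro emeasure_vol_SU2_eq) (simp add: space_vol_SU2)
  \<comment> \<open>The cone over the preimage of \<open>A\<close> is the preimage under
    \<open>?R\<close> of the cone over \<open>A\<close>.\<close>
  also have "{z. z \<in> ?S \<and> ?f z \<in> (**) h -` A \<inter> SU2} = ?R -` ?B \<inter> space lborel"
    using SU2_proj_in_SU2 mem_R f_R by (auto simp del: mem_ball_0)
  also have "emeasure lborel (?R -` ?B \<inter> space lborel) = emeasure (distr lborel lborel ?R) ?B"
    using B by (subst emeasure_distr[OF R]) auto
  also have "\<dots> = emeasure lborel ?B"
    by (simp only: lborel_distr_SU2_action[OF ab(2)])
  also have "2 * \<dots> = emeasure vol_SU2 A"
    by (rule emeasure_vol_SU2_eq[OF A, symmetric])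
  finally show "emeasure (distr vol_SU2 vol_SU2 ((**) h)) A = emeasure vol_SU2 A" .
qed simp


section \<open>Bounded functions and the basis functions\<close>

interpretation vol_SU2: finite_measure vol_SU2
  by (rule finite_measure_vol_SU2)

interpretation vol_SU2_pair: pair_sigma_finite vol_SU2 vol_SU2 ..

text \<open>Test functions for integrating a field: boundedness reduces integrability to the second
  moments of the field. The bound is taken on \<open>SU2\<close>, the space of
  \<open>vol_SU2\<close>.\<close>

definition bounded_borel :: "(complex^2^2 \<Rightarrow> complex) \<Rightarrow> bool" where
  "bounded_borel u \<longleftrightarrow> u \<in> borel_measurable vol_SU2 \<and> (\<exists>B. \<forall>g\<in>SU2. cmod (u g) \<le> B)"

lemma bounded_borelE:
  assumes "bounded_borel u"
  obtains B where "u \<in> borel_measurable vol_SU2" "0 \<le> B" "\<And>g. g \<in> SU2 \<Longrightarrow> cmod (u g) \<le> B"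
proof -
  from assms obtain B where "u \<in> borel_measurable vol_SU2" "\<And>g. g \<in> SU2 \<Longrightarrow> cmod (u g) \<le> B"
    by (auto simp: bounded_borel_def)
  moreover from this(2)[OF mat_1_in_SU2] have "0 \<le> B" by (rule order_trans[OF norm_ge_zero])
  ultimately show ?thesis using that by blast
qed

text \<open>Each entry lies in a column of length 1 of a unitary matrix.\<close>

lemma wigner_D_norm_le_1:
  assumes l: "l \<in> half_nats" and s: "s \<in> idx l" and m: "m \<in> idx l" and g: "g \<in> SU2"
  shows "cmod (wigner_D l m s g) \<le> 1"
proof -
  have "complex_of_real (\<Sum>k\<in>idx l. (cmod (wigner_D l k s g))\<^sup>2) = 1"
    using wigner_D_unitary[OF l s s g]
    by (simp add: complex_norm_square mult.commute del: of_real_power)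
  then have "(\<Sum>k\<in>idx l. (cmod (wigner_D l k s g))\<^sup>2) = 1"
    by (simp only: of_real_eq_1_iff)
  moreover have "(cmod (wigner_D l m s g))\<^sup>2 \<le> (\<Sum>k\<in>idx l. (cmod (wigner_D l k s g))\<^sup>2)"
    by (rule member_le_sum[OF m]) (auto simp: finite_idx[OF l])
  ultimately have "(cmod (wigner_D l m s g))\<^sup>2 \<le> 1\<^sup>2" by simp
  then show ?thesis by (rule power2_le_imp_le) simp
qed

lemma bounded_borel_phi:
  assumes l: "l \<in> half_nats" and s: "s \<in> idx l" and m: "m \<in> idx l"
  shows "bounded_borel (phi l m s)"
proof -
  have "wigner_D l m s \<in> borel_measurable borel"
    by (rule borel_measurable_continuous_onI[OF continuous_on_wigner_D[OF assms]])
  then have "wigner_D l m s \<in> borel_measurable vol_SU2"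
    unfolding measurable_cong_sets[OF sets_vol_SU2 refl] by (rule measurable_restrict_space1)
  then have "phi l m s \<in> borel_measurable vol_SU2"
    unfolding phi_def by (intro borel_measurable_times borel_measurable_const)
  moreover have "cmod (phi l m s g) \<le> cmod (complex_of_real (sqrt (2 * l + 1) / (4 * pi)))" if "g \<in> SU2" for g
    unfolding phi_def norm_mult by (rule mult_left_le[OF wigner_D_norm_le_1[OF assms that]]) simp
  ultimately show ?thesis unfolding bounded_borel_def by blast
qed

lemma borel_measurable_cnj_comp:
  fixes f :: "'a \<Rightarrow> complex"
  shows "f \<in> borel_measurable N \<Longrightarrow> (\<lambda>x. cnj (f x)) \<in> borel_measurable N"
  by (rule measurable_compose[of f N borel cnj])
     (auto intro!: borel_measurable_continuous_onI continuous_intros)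

lemma borel_measurable_integral_mult:
  fixes X :: "'w \<Rightarrow> complex^2^2 \<Rightarrow> complex"
  assumes X: "case_prod X \<in> borel_measurable (M \<Otimes>\<^sub>M vol_SU2)" and u: "u \<in> borel_measurable vol_SU2"
  shows "(\<lambda>\<omega>. \<integral>g. u g * X \<omega> g \<partial>vol_SU2) \<in> borel_measurable M"
proof (rule vol_SU2.borel_measurable_lebesgue_integral)
  have "(\<lambda>p. u (snd p) * case_prod X p) \<in> borel_measurable (M \<Otimes>\<^sub>M vol_SU2)"
    by (intro borel_measurable_times X measurable_compose[OF measurable_snd u])
  then show "(\<lambda>(\<omega>, g). u g * X \<omega> g) \<in> borel_measurable (M \<Otimes>\<^sub>M vol_SU2)"
    by (simp add: case_prod_unfold)
qed

lemma bounded_borel_cnj: "bounded_borel u \<Longrightarrow> bounded_borel (\<lambda>g. cnj (u g))"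
  unfolding bounded_borel_def by (auto intro: borel_measurable_cnj_comp)

lemma phi_mult:
  assumes l: "l \<in> half_nats" and s: "s \<in> idx l" and m: "m \<in> idx l" and "h \<in> SU2" "g \<in> SU2"
  shows "phi l m s (h ** g) = (\<Sum>k\<in>idx l. wigner_D l m k h * phi l k s g)"
  unfolding phi_def wigner_D_mult[OF assms] sum_distrib_left
  by (intro sum.cong refl) (simp only: mult_ac)

lemma integrable_bounded_borel: "bounded_borel u \<Longrightarrow> integrable vol_SU2 u"
  by (elim bounded_borelE, rule vol_SU2.integrable_const_bound)
     (auto simp: space_vol_SU2 intro!: AE_I2)

lemma bounded_borel_mult: "bounded_borel u \<Longrightarrow> bounded_borel v \<Longrightarrow> bounded_borel (\<lambda>g. u g * v g)"
proof (elim bounded_borelE)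
  fix B B'
  assume "u \<in> borel_measurable vol_SU2" "0 \<le> B" "\<And>g. g \<in> SU2 \<Longrightarrow> cmod (u g) \<le> B"
    "v \<in> borel_measurable vol_SU2" "0 \<le> B'" "\<And>g. g \<in> SU2 \<Longrightarrow> cmod (v g) \<le> B'"
  then have "(\<lambda>g. u g * v g) \<in> borel_measurable vol_SU2"
    "\<forall>g\<in>SU2. cmod (u g * v g) \<le> B * B'"
    by (auto simp: norm_mult intro!: mult_mono borel_measurable_times)
  then show ?thesis unfolding bounded_borel_def by blast
qed

lemma half_nats_nonneg: "l \<in> half_nats \<Longrightarrow> 0 \<le> l"
  by (auto simp: half_nats_def)

lemma dimension_nonzero: "l \<in> half_nats \<Longrightarrow> complex_of_real (2 * l + 1) \<noteq> 0"
  using half_nats_nonneg[of l] by (subst of_real_eq_0_iff) linarith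

text \<open>By unitarity the summed integrand is the constant
  \<open>(2 * l + 1) / (16 * pi\<^sup>2)\<close>, and the volume is \<open>16 * pi\<^sup>2\<close>.
  This trace of the Gram matrix of the \<open>phi l k s\<close> suffices later because the
  correlation matrices are multiples of the identity.\<close>

lemma sum_inner_phi:
  assumes l: "l \<in> half_nats" and s: "s \<in> idx l"
  shows "(\<Sum>k\<in>idx l. inner_SU2 (phi l k s) (phi l k s)) = complex_of_real (2 * l + 1)"
proof -
  have l0: "0 \<le> l" by (rule half_nats_nonneg[OF l])
  have int: "integrable vol_SU2 (\<lambda>g. cnj (phi l k s g) * phi l k s g)" if "k \<in> idx l" for k
    by (intro integrable_bounded_borel bounded_borel_mult bounded_borel_cnj bounded_borel_phi l s that)
  have "(\<Sum>k\<in>idx l. cnj (phi l k s g) * phi l k s g) = complex_of_real ((2 * l + 1) / (16 * pi\<^sup>2))"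
    if "g \<in> SU2" for g
  proof -
    have "(\<Sum>k\<in>idx l. cnj (phi l k s g) * phi l k s g)
      = complex_of_real ((sqrt (2 * l + 1) / (4 * pi)) * (sqrt (2 * l + 1) / (4 * pi)))
        * (\<Sum>k\<in>idx l. cnj (wigner_D l k s g) * wigner_D l k s g)"
      unfolding phi_def complex_cnj_mult complex_cnj_complex_of_real of_real_mult sum_distrib_left
      by (intro sum.cong refl) (simp only: mult_ac)
    also have "\<dots> = complex_of_real ((2 * l + 1) / (16 * pi\<^sup>2))"
      unfolding wigner_D_unitary[OF l s s that] using l0
      by (simp add: power2_eq_square flip: of_real_mult)
    finally show ?thesis .
  qed
  then have "(\<integral>g. (\<Sum>k\<in>idx l. cnj (phi l k s g) * phi l k s g) \<partial>vol_SU2)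
    = (\<integral>g. complex_of_real ((2 * l + 1) / (16 * pi\<^sup>2)) \<partial>vol_SU2)"
    by (intro Bochner_Integration.integral_cong refl) (simp add: space_vol_SU2)
  also have "\<dots> = complex_of_real (2 * l + 1)"
    by (simp add: space_vol_SU2 measure_vol_SU2 scaleR_conv_of_real)
  finally show ?thesis
    unfolding inner_SU2_def using int by (simp add: Bochner_Integration.integral_sum)
qed

lemma nat_floor_idx:
  assumes "l \<in> half_nats" "k \<in> idx l"
  shows "real (nat \<lfloor>l + k\<rfloor>) = l + k" "real (nat \<lfloor>l - k\<rfloor>) = l - k"
    "nat \<lfloor>l + k\<rfloor> + nat \<lfloor>l - k\<rfloor> = nat \<lfloor>2 * l\<rfloor>"
proof -
  from assms(1) obtain n where n: "l = real n / 2" by (rule half_nats_cases)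
  from assms(2) obtain i where i: "i \<le> n" "k = real i - real n / 2"
    unfolding n by (rule idx_half_nat_cases)
  show "real (nat \<lfloor>l + k\<rfloor>) = l + k" "real (nat \<lfloor>l - k\<rfloor>) = l - k"
    "nat \<lfloor>l + k\<rfloor> + nat \<lfloor>l - k\<rfloor> = nat \<lfloor>2 * l\<rfloor>"
    unfolding n i(2) floor_half floor_half(2)[OF i(1)] using i(1) by (simp_all add: of_nat_diff)
qed

text \<open>Two non-zero entries make the top row non-zero; the extreme column follows from the top
  row at the inverse by \<open>wigner_D_adjoint\<close>. The numbers 3/5 and 4/5 are rational with
  squares summing to 1.\<close>

lemma SU2_generic_element:
  obtains h where "h \<in> SU2" "\<And>j n. j \<in> half_nats \<Longrightarrow> n \<in> idx j \<Longrightarrow> wigner_D j j n h \<noteq> 0"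
    "\<And>j n. j \<in> half_nats \<Longrightarrow> n \<in> idx j \<Longrightarrow> wigner_D j n j h \<noteq> 0"
proof (rule that[of "SU2_mat (3/5) (4/5)"])
  show "SU2_mat (3/5) (4/5) \<in> SU2" by (intro SU2_I) simp
  show "wigner_D j j n (SU2_mat (3/5) (4/5)) \<noteq> 0" if "j \<in> half_nats" "n \<in> idx j" for j n
    by (rule wigner_D_top_row_nonzero[OF that]) auto
  show "wigner_D j n j (SU2_mat (3/5) (4/5)) \<noteq> 0" if "j \<in> half_nats" "n \<in> idx j" for j n
    using wigner_D_top_row_nonzero[OF that, of "cnj (3/5)" "- (4/5)"]
    unfolding wigner_D_adjoint[OF that(1) top_in_idx[OF that(1)] that(2)] by simp
qed

section \<open>Jointly left-invariant pairs of fields\<close>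

text \<open>\<open>K\<close> bounds the second moments uniformly on \<open>SU2\<close>, which gives
  the integrability for Fubini's theorem. Invariance is imposed on the mixed moment of
  \<open>X\<close> and \<open>Y\<close>, so that a field can be paired with itself, with its
  conjugate or with a constant.\<close>

locale jointly_left_invariant = prob_space M
  for M :: "'w measure" +
  fixes X Y :: "'w \<Rightarrow> complex^2^2 \<Rightarrow> complex" and K :: real
  assumes X_measurable: "case_prod X \<in> borel_measurable (M \<Otimes>\<^sub>M vol_SU2)"
    and Y_measurable: "case_prod Y \<in> borel_measurable (M \<Otimes>\<^sub>M vol_SU2)"
    and X_square: "\<And>g. g \<in> SU2 \<Longrightarrow> integrable M (\<lambda>\<omega>. (cmod (X \<omega> g))\<^sup>2)"
    and Y_square: "\<And>g. g \<in> SU2 \<Longrightarrow> integrable M (\<lambda>\<omega>. (cmod (Y \<omega> g))\<^sup>2)"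
    and X_bound: "\<And>g. g \<in> SU2 \<Longrightarrow> (\<integral>\<omega>. (cmod (X \<omega> g))\<^sup>2 \<partial>M) \<le> K"
    and Y_bound: "\<And>g. g \<in> SU2 \<Longrightarrow> (\<integral>\<omega>. (cmod (Y \<omega> g))\<^sup>2 \<partial>M) \<le> K"
    and invariant: "\<And>h g g'. h \<in> SU2 \<Longrightarrow> g \<in> SU2 \<Longrightarrow> g' \<in> SU2 \<Longrightarrow>
      (\<integral>\<omega>. cnj (X \<omega> (h ** g)) * Y \<omega> (h ** g') \<partial>M) = (\<integral>\<omega>. cnj (X \<omega> g) * Y \<omega> g' \<partial>M)"
begin

section \<open>The kernel of a pair of fields and Fubini's theorem\<close>

abbreviation VV :: "((complex^2^2) \<times> (complex^2^2)) measure" where "VV \<equiv> vol_SU2 \<Otimes>\<^sub>M vol_SU2"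

sublocale VV: finite_measure VV
  by (intro finite_measure_pair_measure finite_measure_vol_SU2)

sublocale M_VV: pair_sigma_finite M VV ..

definition kernel :: "(complex^2^2) \<times> (complex^2^2) \<Rightarrow> complex" where
  "kernel q = (\<integral>\<omega>. cnj (X \<omega> (fst q)) * Y \<omega> (snd q) \<partial>M)"

text \<open>Bilinear, not sesquilinear: a conjugate belongs to the test function that is
  inserted.\<close>

definition pairing :: "(complex^2^2 \<Rightarrow> complex) \<Rightarrow> (complex^2^2 \<Rightarrow> complex) \<Rightarrow> complex" where
  "pairing u v = (\<integral>q. u (fst q) * v (snd q) * kernel q \<partial>VV)"

text \<open>The product of the moduli of the fields is at most the sum of their squares, whose
  expectation is at most \<open>2 * K\<close> at every pair of points, and \<open>VV\<close> is
  finite.\<close>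

lemma integrable_integrand:
  assumes "bounded_borel u" "bounded_borel v"
  shows "integrable (M \<Otimes>\<^sub>M VV)
    (\<lambda>(\<omega>, q). (u (fst q) * cnj (X \<omega> (fst q))) * (v (snd q) * Y \<omega> (snd q)))" (is "integrable _ ?f")
proof (rule integrableI_bounded)
  from assms(1) obtain B where u [measurable]: "u \<in> borel_measurable vol_SU2"
    and B: "0 \<le> B" "\<And>g. g \<in> SU2 \<Longrightarrow> cmod (u g) \<le> B" by (rule bounded_borelE) blast
  from assms(2) obtain B' where v [measurable]: "v \<in> borel_measurable vol_SU2"
    and B': "0 \<le> B'" "\<And>g. g \<in> SU2 \<Longrightarrow> cmod (v g) \<le> B'" by (rule bounded_borelE) blast
  have X': "(\<lambda>p. X (fst p) (fst (snd p))) \<in> borel_measurable (M \<Otimes>\<^sub>M VV)"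
    using measurable_compose[OF _ X_measurable, of "\<lambda>p. (fst p, fst (snd p))" "M \<Otimes>\<^sub>M VV"] by simp
  have Y': "(\<lambda>p. Y (fst p) (snd (snd p))) \<in> borel_measurable (M \<Otimes>\<^sub>M VV)"
    using measurable_compose[OF _ Y_measurable, of "\<lambda>p. (fst p, snd (snd p))" "M \<Otimes>\<^sub>M VV"] by simp
  have "(\<lambda>p. (u (fst (snd p)) * cnj (X (fst p) (fst (snd p))))
      * (v (snd (snd p)) * Y (fst p) (snd (snd p)))) \<in> borel_measurable (M \<Otimes>\<^sub>M VV)"
    by (intro borel_measurable_times borel_measurable_cnj_comp X' Y') measurable
  then show f [measurable]: "?f \<in> borel_measurable (M \<Otimes>\<^sub>M VV)" by (simp add: case_prod_unfold)
  have "(\<integral>\<^sup>+p. ennreal (cmod (?f p)) \<partial>(M \<Otimes>\<^sub>M VV)) = (\<integral>\<^sup>+q. (\<integral>\<^sup>+\<omega>. ennreal (cmod (?f (\<omega>, q))) \<partial>M) \<partial>VV)"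
    by (rule M_VV.nn_integral_snd[symmetric]) measurable
  also have "\<dots> \<le> (\<integral>\<^sup>+q. ennreal (B * B' * (2 * K)) \<partial>VV)"
  proof (intro nn_integral_mono)
    fix q assume "q \<in> space VV"
    then obtain g g' where q: "q = (g, g')" "g \<in> SU2" "g' \<in> SU2"
      by (auto simp: space_pair_measure space_vol_SU2)
    have "cmod (?f (\<omega>, q)) \<le> B * B' * ((cmod (X \<omega> g))\<^sup>2 + (cmod (Y \<omega> g'))\<^sup>2)" for \<omega>
    proof -
      have "cmod (?f (\<omega>, q)) = (cmod (u g) * cmod (v g')) * (cmod (X \<omega> g) * cmod (Y \<omega> g'))"
        by (simp add: q norm_mult)
      also have "\<dots> \<le> (B * B') * ((cmod (X \<omega> g))\<^sup>2 + (cmod (Y \<omega> g'))\<^sup>2)"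
      proof (intro mult_mono)
        show "cmod (X \<omega> g) * cmod (Y \<omega> g') \<le> (cmod (X \<omega> g))\<^sup>2 + (cmod (Y \<omega> g'))\<^sup>2"
          using sum_squares_bound[of "cmod (X \<omega> g)" "cmod (Y \<omega> g')"]
            mult_nonneg_nonneg[OF norm_ge_zero[of "X \<omega> g"] norm_ge_zero[of "Y \<omega> g'"]] by linarith
      qed (use B B' q in auto)
      finally show ?thesis .
    qed
    then have "(\<integral>\<^sup>+\<omega>. ennreal (cmod (?f (\<omega>, q))) \<partial>M)
      \<le> (\<integral>\<^sup>+\<omega>. ennreal (B * B' * ((cmod (X \<omega> g))\<^sup>2 + (cmod (Y \<omega> g'))\<^sup>2)) \<partial>M)"
      by (intro nn_integral_mono ennreal_leI)
    also have "\<dots> = ennreal (\<integral>\<omega>. B * B' * ((cmod (X \<omega> g))\<^sup>2 + (cmod (Y \<omega> g'))\<^sup>2) \<partial>M)"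
      using X_square[OF q(2)] Y_square[OF q(3)] B(1) B'(1)
      by (intro nn_integral_eq_integral) auto
    also have "\<dots> \<le> ennreal (B * B' * (2 * K))"
      using X_square[OF q(2)] Y_square[OF q(3)] X_bound[OF q(2)] Y_bound[OF q(3)] B(1) B'(1)
      by (intro ennreal_leI) (auto intro!: mult_left_mono)
    finally show "(\<integral>\<^sup>+\<omega>. ennreal (cmod (?f (\<omega>, q))) \<partial>M) \<le> ennreal (B * B' * (2 * K))" .
  qed
  also have "\<dots> < \<infinity>"
    using VV.emeasure_finite[of "space VV"] by (simp add: less_top[symmetric] ennreal_mult_eq_top_iff)
  finally show "(\<integral>\<^sup>+p. ennreal (cmod (?f p)) \<partial>(M \<Otimes>\<^sub>M VV)) < \<infinity>" .
qed

lemma integrable_pairing: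
  assumes "bounded_borel u" "bounded_borel v"
  shows "integrable VV (\<lambda>q. u (fst q) * v (snd q) * kernel q)"
proof -
  have "(\<integral>\<omega>. (u (fst q) * cnj (X \<omega> (fst q))) * (v (snd q) * Y \<omega> (snd q)) \<partial>M)
    = u (fst q) * v (snd q) * kernel q" for q
    unfolding kernel_def by (subst integral_mult_right_zero[symmetric]) (simp only: mult_ac)
  with M_VV.integrable_snd[OF integrable_integrand[OF assms]] show ?thesis by simp
qed

text \<open>Fubini's theorem in both orders: integrated first over \<open>VV\<close>, the integrand
  splits into a product of two integrals; integrated first over \<open>M\<close>, it becomes the
  kernel.\<close>

lemma
  assumes "bounded_borel u" "bounded_borel v"
  shows integrable_product_moment:
      "integrable M (\<lambda>\<omega>. (\<integral>g. u g * cnj (X \<omega> g) \<partial>vol_SU2) * (\<integral>g. v g * Y \<omega> g \<partial>vol_SU2))" (is ?int)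
    and product_moment_eq_pairing:
      "(\<integral>\<omega>. (\<integral>g. u g * cnj (X \<omega> g) \<partial>vol_SU2) * (\<integral>g. v g * Y \<omega> g \<partial>vol_SU2) \<partial>M) = pairing u v" (is ?eq)
proof -
  from assms have [measurable]: "u \<in> borel_measurable vol_SU2" "v \<in> borel_measurable vol_SU2"
    by (auto simp: bounded_borel_def)
  let ?f = "\<lambda>\<omega> q. (u (fst q) * cnj (X \<omega> (fst q))) * (v (snd q) * Y \<omega> (snd q))"
  let ?g = "\<lambda>\<omega>. (\<integral>g. u g * cnj (X \<omega> g) \<partial>vol_SU2) * (\<integral>g. v g * Y \<omega> g \<partial>vol_SU2)"
  note int = integrable_integrand[OF assms]
  have "case_prod (\<lambda>\<omega> g. cnj (X \<omega> g)) \<in> borel_measurable (M \<Otimes>\<^sub>M vol_SU2)"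
    using borel_measurable_cnj_comp[OF X_measurable] by (simp add: case_prod_unfold)
  then have g: "?g \<in> borel_measurable M"
    by (intro borel_measurable_times borel_measurable_integral_mult Y_measurable) auto
  \<comment> \<open>The splitting holds for those \<open>\<omega>\<close> whose slice is integrable
    on \<open>VV\<close>, hence almost surely.\<close>
  have ae: "AE \<omega> in M. (\<integral>q. ?f \<omega> q \<partial>VV) = ?g \<omega>"
    using M_VV.AE_integrable_fst[OF int]
  proof eventually_elim
    fix \<omega> assume "integrable VV (?f \<omega>)"
    from vol_SU2_pair.integral_fst'[OF this] show "(\<integral>q. ?f \<omega> q \<partial>VV) = ?g \<omega>"
      by simp
  qed
  have f: "(\<lambda>\<omega>. \<integral>q. ?f \<omega> q \<partial>VV) \<in> borel_measurable M"
    using M_VV.integrable_fst[OF int] by (rule borel_measurable_integrable)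
  show ?int
    using M_VV.integrable_fst[OF int] integrable_cong_AE[OF f g ae] by simp
  have "(\<integral>\<omega>. ?g \<omega> \<partial>M) = (\<integral>\<omega>. (\<integral>q. ?f \<omega> q \<partial>VV) \<partial>M)"
    by (rule integral_cong_AE[OF f g ae, symmetric])
  also have "\<dots> = (\<integral>q. (\<integral>\<omega>. ?f \<omega> q \<partial>M) \<partial>VV)"
    by (simp only: M_VV.integral_fst[OF int] M_VV.integral_snd[OF int])
  also have "\<dots> = pairing u v"
    unfolding pairing_def
  proof (intro Bochner_Integration.integral_cong refl)
    fix q show "(\<integral>\<omega>. ?f \<omega> q \<partial>M) = u (fst q) * v (snd q) * kernel q"
      unfolding kernel_def by (subst integral_mult_right_zero[symmetric]) (simp only: mult_ac)
  qed
  finally show ?eq .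
qed

text \<open>The volume on each factor is invariant under translation by \<open>h\<close>, and so is
  the kernel under the simultaneous translation.\<close>

lemma pairing_translate:
  assumes "bounded_borel u" "bounded_borel v" and h: "h \<in> SU2"
  shows "pairing (\<lambda>g. u (h ** g)) (\<lambda>g. v (h ** g)) = pairing u v"
proof -
  let ?G = "\<lambda>q. u (fst q) * v (snd q) * kernel q"
  let ?T = "\<lambda>(x, y). (h ** x, h ** y)"
  note h' = measurable_SU2_mult[OF h]
  have "VV = distr vol_SU2 vol_SU2 ((**) h) \<Otimes>\<^sub>M distr vol_SU2 vol_SU2 ((**) h)"
    by (simp only: distr_vol_SU2_mult[OF h])
  also have "\<dots> = distr VV VV ?T"
    by (rule pair_measure_distr[OF h' h'])
       (simp only: distr_vol_SU2_mult[OF h] vol_SU2.sigma_finite_measure_axioms)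
  finally have VV: "VV = distr VV VV ?T" .
  have T: "?T \<in> measurable VV VV"
    using h' by measurable
  have "pairing u v = (\<integral>q. ?G q \<partial>distr VV VV ?T)"
    unfolding pairing_def by (subst VV) (rule refl)
  also have "\<dots> = (\<integral>q. ?G (?T q) \<partial>VV)"
    by (rule integral_distr[OF T borel_measurable_integrable[OF integrable_pairing[OF assms(1,2)]]])
  also have "\<dots> = pairing (\<lambda>g. u (h ** g)) (\<lambda>g. v (h ** g))"
    unfolding pairing_def kernel_def
    by (intro Bochner_Integration.integral_cong refl)
       (auto simp: space_pair_measure space_vol_SU2 invariant[OF h])
  finally show ?thesis ..
qed

text \<open>Bilinearity, with the expansions assumed on \<open>SU2\<close>, which is where
  \<open>phi_mult\<close> supplies them.\<close>

lemma pairing_sum: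
  assumes "finite I" "finite J" "\<And>i. i \<in> I \<Longrightarrow> bounded_borel (u i)" "\<And>j. j \<in> J \<Longrightarrow> bounded_borel (v j)"
    and u': "\<And>g. g \<in> SU2 \<Longrightarrow> u' g = (\<Sum>i\<in>I. c i * u i g)"
    and v': "\<And>g. g \<in> SU2 \<Longrightarrow> v' g = (\<Sum>j\<in>J. d j * v j g)"
  shows "pairing u' v' = (\<Sum>i\<in>I. \<Sum>j\<in>J. c i * d j * pairing (u i) (v j))"
proof -
  have "pairing u' v' = (\<integral>q. (\<Sum>i\<in>I. \<Sum>j\<in>J. c i * d j * (u i (fst q) * v j (snd q) * kernel q)) \<partial>VV)"
    unfolding pairing_def
  proof (intro Bochner_Integration.integral_cong refl)
    fix q assume "q \<in> space VV"
    then have "fst q \<in> SU2" "snd q \<in> SU2" by (auto simp: space_pair_measure space_vol_SU2)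
    then show "u' (fst q) * v' (snd q) * kernel q
      = (\<Sum>i\<in>I. \<Sum>j\<in>J. c i * d j * (u i (fst q) * v j (snd q) * kernel q))"
      unfolding u'[OF \<open>fst q \<in> SU2\<close>] v'[OF \<open>snd q \<in> SU2\<close>] sum_product
      unfolding sum_distrib_right
      by (intro sum.cong refl) (simp only: mult_ac)
  qed
  also have "\<dots> = (\<Sum>i\<in>I. \<Sum>j\<in>J. c i * d j * pairing (u i) (v j))"
    unfolding pairing_def using assms(3,4)
    by (simp add: Bochner_Integration.integral_sum integrable_pairing)
  finally show ?thesis .
qed

section \<open>The correlation matrix for fixed degrees and columns\<close>

context
  fixes l l' s s' :: real
  assumes l: "l \<in> half_nats" and l': "l' \<in> half_nats" and s: "s \<in> idx l" and s': "s' \<in> idx l'"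
begin

definition corr :: "real \<Rightarrow> real \<Rightarrow> complex" where
  "corr m m' = (\<integral>\<omega>. cnj (coeff_field X l m s \<omega>) * coeff_field Y l' m' s' \<omega> \<partial>M)"

lemma
  assumes m: "m \<in> idx l" and m': "m' \<in> idx l'"
  shows corr_eq_pairing: "corr m m' = pairing (phi l m s) (\<lambda>g. cnj (phi l' m' s' g))"
    and integrable_corr: "integrable M (\<lambda>\<omega>. cnj (coeff_field X l m s \<omega>) * coeff_field Y l' m' s' \<omega>)"
proof -
  have "cnj (coeff_field X l m s \<omega>) = (\<integral>g. phi l m s g * cnj (X \<omega> g) \<partial>vol_SU2)" for \<omega>
    unfolding coeff_field_def inner_SU2_def by (simp flip: Bochner_Integration.integral_cnj)
  then have eq: "(\<lambda>\<omega>. cnj (coeff_field X l m s \<omega>) * coeff_field Y l' m' s' \<omega>)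
    = (\<lambda>\<omega>. (\<integral>g. phi l m s g * cnj (X \<omega> g) \<partial>vol_SU2) * (\<integral>g. cnj (phi l' m' s' g) * Y \<omega> g \<partial>vol_SU2))"
    by (simp add: coeff_field_def inner_SU2_def)
  have u: "bounded_borel (phi l m s)" by (rule bounded_borel_phi[OF l s m])
  have v: "bounded_borel (\<lambda>g. cnj (phi l' m' s' g))"
    by (rule bounded_borel_cnj[OF bounded_borel_phi[OF l' s' m']])
  show "integrable M (\<lambda>\<omega>. cnj (coeff_field X l m s \<omega>) * coeff_field Y l' m' s' \<omega>)"
    unfolding eq by (rule integrable_product_moment[OF u v])
  show "corr m m' = pairing (phi l m s) (\<lambda>g. cnj (phi l' m' s' g))"
    unfolding corr_def eq by (rule product_moment_eq_pairing[OF u v])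
qed

text \<open>Translating both test functions by \<open>h\<close> does not change the pairing, and
  \<open>phi_mult\<close> expands the translates. In matrix form,
  \<open>C = D(h) C D'(h)^*\<close>.\<close>

lemma corr_conjugate:
  assumes m: "m \<in> idx l" and m': "m' \<in> idx l'" and h: "h \<in> SU2"
  shows "corr m m' = (\<Sum>k\<in>idx l. \<Sum>k'\<in>idx l'. wigner_D l m k h * cnj (wigner_D l' m' k' h) * corr k k')"
proof -
  have "corr m m' = pairing (\<lambda>g. phi l m s (h ** g)) (\<lambda>g. cnj (phi l' m' s' (h ** g)))"
    unfolding corr_eq_pairing[OF m m']
    by (rule pairing_translate[symmetric, OF bounded_borel_phi[OF l s m]
        bounded_borel_cnj[OF bounded_borel_phi[OF l' s' m']] h])
  also have "\<dots> = (\<Sum>k\<in>idx l. \<Sum>k'\<in>idx l'. wigner_D l m k h * cnj (wigner_D l' m' k' h)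
      * pairing (phi l k s) (\<lambda>g. cnj (phi l' k' s' g)))"
    by (rule pairing_sum)
       (auto simp: finite_idx l l' phi_mult[OF l s m h] phi_mult[OF l' s' m' h]
         intro!: bounded_borel_cnj bounded_borel_phi s s')
  finally show ?thesis by (simp add: corr_eq_pairing)
qed

text \<open>Multiply \<open>corr_conjugate\<close> from the right by \<open>D'(h)\<close>, which is
  unitary.\<close>

lemma corr_intertwines:
  assumes m: "m \<in> idx l" and n: "n \<in> idx l'" and h: "h \<in> SU2"
  shows "(\<Sum>m'\<in>idx l'. corr m m' * wigner_D l' m' n h) = (\<Sum>k\<in>idx l. wigner_D l m k h * corr k n)"
proof -
  have "(\<Sum>m'\<in>idx l'. corr m m' * wigner_D l' m' n h)
    = (\<Sum>m'\<in>idx l'. \<Sum>k\<in>idx l. \<Sum>k'\<in>idx l'.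
        wigner_D l m k h * corr k k' * (cnj (wigner_D l' m' k' h) * wigner_D l' m' n h))"
  proof (intro sum.cong refl)
    fix m' assume m': "m' \<in> idx l'"
    show "corr m m' * wigner_D l' m' n h = (\<Sum>k\<in>idx l. \<Sum>k'\<in>idx l'.
        wigner_D l m k h * corr k k' * (cnj (wigner_D l' m' k' h) * wigner_D l' m' n h))"
      unfolding corr_conjugate[OF m m' h] sum_distrib_right by (intro sum.cong refl) (simp only: mult_ac)
  qed
  also have "\<dots> = (\<Sum>k\<in>idx l. \<Sum>m'\<in>idx l'. \<Sum>k'\<in>idx l'.
        wigner_D l m k h * corr k k' * (cnj (wigner_D l' m' k' h) * wigner_D l' m' n h))"
    by (rule sum.swap)
  also have "\<dots> = (\<Sum>k\<in>idx l. \<Sum>k'\<in>idx l'. wigner_D l m k h * corr k k'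
      * (\<Sum>m'\<in>idx l'. cnj (wigner_D l' m' k' h) * wigner_D l' m' n h))"
    unfolding sum_distrib_left by (rule sum.cong[OF refl], rule sum.swap)
  also have "\<dots> = (\<Sum>k\<in>idx l. \<Sum>k'\<in>idx l'. if k' = n then wigner_D l m k h * corr k k' else 0)"
    by (intro sum.cong refl) (simp add: wigner_D_unitary[OF l' n _ h])
  also have "\<dots> = (\<Sum>k\<in>idx l. wigner_D l m k h * corr k n)"
    using n finite_idx[OF l'] by simp
  finally show ?thesis .
qed

text \<open>
  At \<open>h = diag(cis t, cis (- t))\<close> the entry \<open>(m, m')\<close> is multiplied by
  \<open>cis (2 * (m' - m) * t)\<close>; the angle below makes this factor \<open>- 1\<close>.
\<close>

lemma corr_off_diagonal:
  assumes m: "m \<in> idx l" and m': "m' \<in> idx l'" and "m \<noteq> m'"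
  shows "corr m m' = 0"
proof -
  define t where "t = pi / (2 * (m' - m))"
  have t: "2 * (m' - m) * t = pi" using \<open>m \<noteq> m'\<close> by (simp add: t_def)
  let ?h = "SU2_mat (cis t) 0"
  have h: "?h \<in> SU2" by (intro SU2_I) (simp add: cis_cnj cis_mult)
  have D: "wigner_D j k i ?h = of_bool (k = i) * cis (- (2 * i * t))"
    if "j \<in> half_nats" "i \<in> idx j" "k \<in> idx j" for j k i
    by (simp add: wigner_D_diagonal that nat_floor_idx cis_cnj cis_mult Complex.DeMoivre)
       (simp add: algebra_simps)
  have "corr m m' = (\<Sum>k\<in>idx l. \<Sum>k'\<in>idx l'. if k = m \<and> k' = m' then cis (- (2 * m * t)) * cis (2 * m' * t) * corr m m' else 0)"
    by (subst corr_conjugate[OF m m' h], intro sum.cong refl) (auto simp: D l l' m m' cis_cnj)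
  also have "\<dots> = (\<Sum>k\<in>idx l. if k = m then cis (- (2 * m * t)) * cis (2 * m' * t) * corr m m' else 0)"
    using m' finite_idx[OF l'] by (intro sum.cong refl) auto
  also have "\<dots> = cis (- (2 * m * t)) * cis (2 * m' * t) * corr m m'"
    using m finite_idx[OF l] by simp
  also have "cis (- (2 * m * t)) * cis (2 * m' * t) = cis pi"
    unfolding cis_mult t[symmetric] by (simp add: algebra_simps)
  finally show ?thesis by (simp add: cis_pi)
qed

text \<open>Since the matrix is diagonal, each sum in \<open>corr_intertwines\<close> keeps at most
  one term. The case distinctions serve different degrees, where an index of one side may be missing
  on the other.\<close>

lemma corr_intertwines_diagonal:
  assumes m: "m \<in> idx l" and n: "n \<in> idx l'" and h: "h \<in> SU2"
  shows "(if m \<in> idx l' then corr m m * wigner_D l' m n h else 0)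
    = (if n \<in> idx l then wigner_D l m n h * corr n n else 0)"
proof -
  have "(\<Sum>m'\<in>idx l'. corr m m' * wigner_D l' m' n h)
    = (\<Sum>m'\<in>idx l'. if m' = m then corr m m * wigner_D l' m n h else 0)"
    using corr_off_diagonal[OF m] by (intro sum.cong refl) auto
  moreover have "(\<Sum>k\<in>idx l. wigner_D l m k h * corr k n)
    = (\<Sum>k\<in>idx l. if k = n then wigner_D l m n h * corr n n else 0)"
    using corr_off_diagonal[OF _ n] by (intro sum.cong refl) auto
  ultimately show ?thesis
    using corr_intertwines[OF assms] finite_idx[OF l] finite_idx[OF l'] by simp
qed

text \<open>The top index of the larger degree does not occur in the smaller one. In the column or
  row of that index, one side of the relation is 0 and the other is \<open>corr m m\<close> times a
  non-zero Wigner entry.\<close>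

lemma corr_different_degree:
  assumes "l \<noteq> l'" and m: "m \<in> idx l" "m \<in> idx l'"
  shows "corr m m = 0"
proof -
  obtain h where h: "h \<in> SU2"
    and row: "\<And>j n. j \<in> half_nats \<Longrightarrow> n \<in> idx j \<Longrightarrow> wigner_D j j n h \<noteq> 0"
    and col: "\<And>j n. j \<in> half_nats \<Longrightarrow> n \<in> idx j \<Longrightarrow> wigner_D j n j h \<noteq> 0"
    by (rule SU2_generic_element) blast
  from \<open>l \<noteq> l'\<close> consider "l < l'" | "l' < l" by linarith
  then show ?thesis
  proof cases
    case 1
    then have "l' \<notin> idx l" by (auto simp: idx_def)
    with corr_intertwines_diagonal[OF m(1) top_in_idx[OF l'] h] m col[OF l'] show ?thesis by auto
  next
    case 2
    then have "l \<notin> idx l'" by (auto simp: idx_def)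
    with corr_intertwines_diagonal[OF top_in_idx[OF l] m(2) h] m row[OF l] show ?thesis by auto
  qed
qed

text \<open>The entry \<open>(l, k)\<close> of the relation compares \<open>corr l l\<close> with
  \<open>corr k k\<close>, both multiplied by the same non-zero entry of the top row.\<close>

lemma corr_constant_diagonal:
  assumes "l = l'" and m: "m \<in> idx l" and n: "n \<in> idx l"
  shows "corr m m = corr n n"
proof -
  obtain h where h: "h \<in> SU2"
    and row: "\<And>j n. j \<in> half_nats \<Longrightarrow> n \<in> idx j \<Longrightarrow> wigner_D j j n h \<noteq> 0"
    by (rule SU2_generic_element) blast
  have "corr k k = corr l l" if "k \<in> idx l" for k
    using corr_intertwines_diagonal[OF top_in_idx[OF l] _ h, of k] row[OF l that] that
      top_in_idx[OF l] \<open>l = l'\<close> by auto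
  with m n show ?thesis by metis
qed

end

text \<open>Each diagonal entry of a multiple of the identity is its trace divided by the size
  \<open>2 * l + 1\<close>.\<close>

lemma coefficient_correlation:
  assumes l: "l \<in> half_nats" and l': "l' \<in> half_nats" and s: "s \<in> idx l" and s': "s' \<in> idx l'"
    and m: "m \<in> idx l" and m': "m' \<in> idx l'"
  shows "(\<integral>\<omega>. cnj (coeff_field X l m s \<omega>) * coeff_field Y l' m' s' \<omega> \<partial>M)
    = of_bool (m = m') * (of_bool (l = l') / complex_of_real (2 * l + 1)) *
      (\<Sum>k\<in>idx l. \<integral>\<omega>. cnj (coeff_field X l k s \<omega>) * coeff_field Y l k s' \<omega> \<partial>M)"
proof (cases "m = m' \<and> l = l'")
  case True
  then have eq: "l' = l" "m' = m" by auto
  with s' have s': "s' \<in> idx l" by simp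
  have "corr l l s s' k k = corr l l s s' m m" if "k \<in> idx l" for k
    by (rule corr_constant_diagonal[OF l l s s' refl that m])
  then have "(\<Sum>k\<in>idx l. corr l l s s' k k) = complex_of_real (2 * l + 1) * corr l l s s' m m"
    by (simp add: card_idx[OF l, symmetric])
  then show ?thesis
    using dimension_nonzero[OF l] by (simp add: eq corr_def[OF l l s s'])
next
  case False
  then have "corr l l' s s' m m' = 0"
    using corr_off_diagonal[OF assms] corr_different_degree[OF l l' s s'] m m' by metis
  with False show ?thesis by (auto simp: corr_def[OF l l' s s'])
qed

end

section \<open>Coefficients of a weakly left-invariant field\<close>

text \<open>Translation by \<open>g\<close> moves the identity matrix to \<open>g\<close>. This
  supplies the uniform bound on the second moments.\<close>

lemma weakly2_left_invariant_second_moment: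
  assumes "weakly2_left_invariant M X" and g: "g \<in> SU2"
  shows "(\<integral>\<omega>. (cmod (X \<omega> g))\<^sup>2 \<partial>M) = (\<integral>\<omega>. (cmod (X \<omega> (mat 1)))\<^sup>2 \<partial>M)"
proof -
  have "(\<integral>\<omega>. (cnj ^^ 1) (X \<omega> (g ** mat 1)) * (cnj ^^ 0) (X \<omega> (g ** mat 1)) \<partial>M)
    = (\<integral>\<omega>. (cnj ^^ 1) (X \<omega> (mat 1)) * (cnj ^^ 0) (X \<omega> (mat 1)) \<partial>M)"
    using assms mat_1_in_SU2 unfolding weakly2_left_invariant_def by blast
  then have "(\<integral>\<omega>. complex_of_real ((cmod (X \<omega> g))\<^sup>2) \<partial>M)
    = (\<integral>\<omega>. complex_of_real ((cmod (X \<omega> (mat 1)))\<^sup>2) \<partial>M)"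
    unfolding complex_norm_square by (simp add: mult.commute)
  then show ?thesis by (simp only: integral_complex_of_real of_real_eq_iff)
qed

text \<open>The maximum with 1 makes \<open>K\<close> a bound for the constant field as well. The
  invariance of the three pairs is that of \<open>E (cnj X * X)\<close>, of \<open>E (X * X)\<close>
  and of the mean.\<close>

lemma jointly_left_invariant_weakly2:
  assumes X: "random_field M X" and inv: "weakly2_left_invariant M X"
  defines "K \<equiv> max 1 (\<integral>\<omega>. (cmod (X \<omega> (mat 1)))\<^sup>2 \<partial>M)"
  shows "jointly_left_invariant M X X K"
    and "jointly_left_invariant M (\<lambda>\<omega> g. cnj (X \<omega> g)) X K"
    and "jointly_left_invariant M (\<lambda>_ _. 1) X K"
proof -
  from X interpret prob_space M by (simp add: random_field_def)
  have meas: "case_prod X \<in> borel_measurable (M \<Otimes>\<^sub>M vol_SU2)"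
    using X by (simp add: random_field_def)
  have meas_cnj: "case_prod (\<lambda>\<omega> g. cnj (X \<omega> g)) \<in> borel_measurable (M \<Otimes>\<^sub>M vol_SU2)"
    using borel_measurable_cnj_comp[OF meas] by (simp add: case_prod_unfold)
  have sq: "integrable M (\<lambda>\<omega>. (cmod (X \<omega> g))\<^sup>2)" if "g \<in> SU2" for g
    using inv that by (simp add: weakly2_left_invariant_def)
  have bound: "(\<integral>\<omega>. (cmod (X \<omega> g))\<^sup>2 \<partial>M) \<le> K" if "g \<in> SU2" for g
    using weakly2_left_invariant_second_moment[OF inv that] by (simp add: K_def)
  have moment: "(\<integral>\<omega>. (cnj ^^ i) (X \<omega> (h ** g1)) * (cnj ^^ 0) (X \<omega> (h ** g2)) \<partial>M) =
        (\<integral>\<omega>. (cnj ^^ i) (X \<omega> g1) * (cnj ^^ 0) (X \<omega> g2) \<partial>M)"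
    if "h \<in> SU2" "g1 \<in> SU2" "g2 \<in> SU2" "i \<in> {0, 1}" for h g1 g2 i
    using inv that unfolding weakly2_left_invariant_def by blast
  have mean: "(\<integral>\<omega>. X \<omega> (h ** g) \<partial>M) = (\<integral>\<omega>. X \<omega> g \<partial>M)" if "h \<in> SU2" "g \<in> SU2" for h g
    using inv that unfolding weakly2_left_invariant_def by blast
  show "jointly_left_invariant M X X K"
    by unfold_locales (use meas sq bound moment[of _ _ _ 1] in auto)
  show "jointly_left_invariant M (\<lambda>\<omega> g. cnj (X \<omega> g)) X K"
    by unfold_locales (use meas meas_cnj sq bound moment[of _ _ _ 0] in auto)
  show "jointly_left_invariant M (\<lambda>_ _. 1) X K"
    by unfold_locales (use meas sq bound mean in \<open>auto simp: K_def prob_space\<close>)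
qed

lemma cnj_phi:
  assumes "l \<in> half_nats" "s \<in> idx l" "m \<in> idx l"
  shows "cnj (phi l m s g) = (- 1) ^ nat \<lfloor>l - m\<rfloor> * (- 1) ^ nat \<lfloor>l - s\<rfloor> * phi l (- m) (- s) g"
  unfolding phi_def complex_cnj_mult complex_cnj_complex_of_real cnj_wigner_D[OF assms]
  by (simp only: mult_ac)

text \<open>Exhibits a coefficient of \<open>X\<close> as a conjugate, so that a moment without
  conjugate becomes a correlation for the pair \<open>(cnj X, X)\<close>.\<close>

lemma coeff_field_cnj:
  assumes "l \<in> half_nats" "s \<in> idx l" "m \<in> idx l"
  shows "coeff_field X l m s \<omega> = (- 1) ^ nat \<lfloor>l - m\<rfloor> * (- 1) ^ nat \<lfloor>l - s\<rfloor> *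
    cnj (coeff_field (\<lambda>\<omega> g. cnj (X \<omega> g)) l (- m) (- s) \<omega>)"
  unfolding coeff_field_def inner_SU2_def cnj_phi[OF assms]
  by (simp add: mult.assoc flip: Bochner_Integration.integral_cnj)

lemma inner_component_field:
  assumes l: "l \<in> half_nats" and s: "s \<in> idx l"
  shows "inner_SU2 (component_field X l s \<omega>) (component_field X l s \<omega>)
    = (\<Sum>k\<in>idx l. \<Sum>j\<in>idx l. inner_SU2 (phi l k s) (phi l j s)
        * (cnj (coeff_field X l k s \<omega>) * coeff_field X l j s \<omega>))"
proof -
  have int: "integrable vol_SU2 (\<lambda>g. cnj (phi l k s g) * phi l j s g)"
    if "k \<in> idx l" "j \<in> idx l" for k j
    by (intro integrable_bounded_borel bounded_borel_mult bounded_borel_cnj bounded_borel_phi l s that)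
  have "inner_SU2 (component_field X l s \<omega>) (component_field X l s \<omega>)
    = (\<integral>g. (\<Sum>k\<in>idx l. \<Sum>j\<in>idx l. (cnj (phi l k s g) * phi l j s g)
        * (cnj (coeff_field X l k s \<omega>) * coeff_field X l j s \<omega>)) \<partial>vol_SU2)"
    unfolding inner_SU2_def component_field_def cnj_sum complex_cnj_mult sum_product
    by (simp only: mult_ac)
  also have "\<dots> = (\<Sum>k\<in>idx l. \<Sum>j\<in>idx l. inner_SU2 (phi l k s) (phi l j s)
        * (cnj (coeff_field X l k s \<omega>) * coeff_field X l j s \<omega>))"
    unfolding inner_SU2_def using int by (simp add: Bochner_Integration.integral_sum)
  finally show ?thesis .
qed

text \<open>For \<open>s \<noteq> s'\<close> the two components are orthogonal because the
  \<open>phi\<close> are, although their coefficients may be correlated; the general formula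
  therefore contains the inner product of the coefficient vectors. The signs with
  \<open>l + k\<close> and \<open>l - k\<close> differ by the factor (-1)^(2l), hence the condition
  on the former version; for \<open>s = s'\<close> and odd \<open>2 * l\<close> both sums
  vanish.\<close>

theorem theorem63:
  fixes M :: "'w measure"
    and X :: "'w \<Rightarrow> complex^2^2 \<Rightarrow> complex"
    and a :: "real \<Rightarrow> real \<Rightarrow> real \<Rightarrow> 'w \<Rightarrow> complex"
    and l l' m m' s s' :: real
  assumes "random_field M X"
    and "weakly2_left_invariant M X"
    and a: "a = coeff_field X"
    and "l \<in> half_nats" and "m \<in> idx l" and "s \<in> idx l"
    and "l' \<in> half_nats" and "m' \<in> idx l'" and "s' \<in> idx l'"
  shows
    "a l m s \<in> borel_measurable M \<and> integrable M (\<lambda>\<omega>. (cmod (a l m s \<omega>))\<^sup>2) \<and>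
     (l \<noteq> 0 \<longrightarrow> (\<integral>\<omega>. a l m s \<omega> \<partial>M) = 0) \<and>
     (s = s' \<longrightarrow>
       (\<integral>\<omega>. cnj (a l m s \<omega>) * a l' m' s' \<omega> \<partial>M) =
         of_bool (m = m') * (of_bool (l = l') / complex_of_real (2 * l + 1)) *
         (\<integral>\<omega>. inner_SU2 (component_field X l s \<omega>) (component_field X l s' \<omega>) \<partial>M)) \<and>
     (\<integral>\<omega>. cnj (a l m s \<omega>) * a l' m' s' \<omega> \<partial>M) =
       of_bool (m = m') * (of_bool (l = l') / complex_of_real (2 * l + 1)) *
       (\<Sum>k\<in>idx l. \<integral>\<omega>. cnj (a l k s \<omega>) * a l k s' \<omega> \<partial>M) \<and>
     (\<forall>n\<in>idx l. complex_variance M (a l m s) = complex_variance M (a l n s)) \<and>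
     (s = s' \<or> l \<in> \<nat> \<longrightarrow>
       (\<integral>\<omega>. a l m s \<omega> * a l' m' s' \<omega> \<partial>M) =
         of_bool (- m = m') * (- 1) ^ nat \<lfloor>l - m\<rfloor> *
         (of_bool (l = l') / complex_of_real (2 * l + 1)) *
         (\<Sum>k\<in>idx l. (- 1) ^ nat \<lfloor>l + k\<rfloor> * (\<integral>\<omega>. a l k s \<omega> * a l (- k) s' \<omega> \<partial>M))) \<and>
     (\<integral>\<omega>. a l m s \<omega> * a l' m' s' \<omega> \<partial>M) =
       of_bool (- m = m') * (- 1) ^ nat \<lfloor>l - m\<rfloor> *
       (of_bool (l = l') / complex_of_real (2 * l + 1)) *
       (\<Sum>k\<in>idx l. (- 1) ^ nat \<lfloor>l - k\<rfloor> * (\<integral>\<omega>. a l k s \<omega> * a l (- k) s' \<omega> \<partial>M))"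
proof -
  note inv = jointly_left_invariant_weakly2[OF assms(1,2)]
  note l = assms(4) and m = assms(5) and s = assms(6)
    and l' = assms(7) and m' = assms(8) and s' = assms(9)
  let ?b = "coeff_field (\<lambda>\<omega> g. cnj (X \<omega> g))"

  have meas: "a l k s \<in> borel_measurable M" if "k \<in> idx l" for k
  proof -
    have "(\<lambda>g. cnj (phi l k s g)) \<in> borel_measurable vol_SU2"
      using bounded_borel_cnj[OF bounded_borel_phi[OF l s that]] by (simp add: bounded_borel_def)
    from borel_measurable_integral_mult[OF _ this, of X M] show ?thesis
      using assms(1) by (simp add: a coeff_field_def[abs_def] inner_SU2_def random_field_def)
  qed
  have int: "integrable M (\<lambda>\<omega>. cnj (a l k s \<omega>) * a l j s \<omega>)" if "k \<in> idx l" "j \<in> idx l" for k j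
    unfolding a by (rule jointly_left_invariant.integrable_corr[OF inv(1) l l s s that])
  have square: "integrable M (\<lambda>\<omega>. (cmod (a l m s \<omega>))\<^sup>2)"
  proof -
    have "integrable M (\<lambda>\<omega>. complex_of_real ((cmod (a l m s \<omega>))\<^sup>2))"
      using int[OF m m] unfolding complex_norm_square by (simp add: mult.commute)
    then show ?thesis by (simp only: complex_of_real_integrable_eq)
  qed

  have mean: "(\<integral>\<omega>. a l k s \<omega> \<partial>M) = 0" if "l \<noteq> 0" "k \<in> idx l" for k
  proof -
    have 0: "0 \<in> half_nats" "0 \<in> idx 0" by (auto simp: half_nats_def idx_def)
    have "phi 0 0 0 g = complex_of_real (1 / (4 * pi))" for g
      unfolding phi_def wigner_D_top_row[OF 0] by (simp add: psi_def)
    \<comment> \<open>The constant field has the non-zero coefficient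
      \<open>16 * pi\<^sup>2 / (4 * pi)\<close> of degree 0, so up to this factor the mean is a
      correlation between the degrees 0 and \<open>l\<close>.\<close>
    then have const: "coeff_field (\<lambda>_ _. 1) 0 0 0 \<omega> = complex_of_real (4 * pi)" for \<omega> :: 'w
      by (simp add: coeff_field_def inner_SU2_def space_vol_SU2 measure_vol_SU2
          scaleR_conv_of_real power2_eq_square)
    have "(\<integral>\<omega>. cnj (coeff_field (\<lambda>_ _. 1) 0 0 0 \<omega>) * a l k s \<omega> \<partial>M) = 0"
      using jointly_left_invariant.coefficient_correlation[OF inv(3) 0(1) l 0(2) s 0(2) that(2)] that(1)
      by (simp add: a)
    then show ?thesis by (simp add: const)
  qed

  have corr: "(\<integral>\<omega>. cnj (a l k s \<omega>) * a j n t \<omega> \<partial>M) =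
       of_bool (k = n) * (of_bool (l = j) / complex_of_real (2 * l + 1)) *
       (\<Sum>k\<in>idx l. \<integral>\<omega>. cnj (a l k s \<omega>) * a l k t \<omega> \<partial>M)"
    if "k \<in> idx l" "j \<in> half_nats" "n \<in> idx j" "t \<in> idx j" for j k n t
    unfolding a
    by (rule jointly_left_invariant.coefficient_correlation[OF inv(1) l that(2) s that(4) that(1,3)])

  have component: "(\<integral>\<omega>. inner_SU2 (component_field X l s \<omega>) (component_field X l s \<omega>) \<partial>M)
    = (\<Sum>k\<in>idx l. \<integral>\<omega>. cnj (a l k s \<omega>) * a l k s \<omega> \<partial>M)" (is "_ = ?S")
  proof -
    have "(\<integral>\<omega>. inner_SU2 (component_field X l s \<omega>) (component_field X l s \<omega>) \<partial>M)
      = (\<Sum>k\<in>idx l. \<Sum>j\<in>idx l. inner_SU2 (phi l k s) (phi l j s) * (\<integral>\<omega>. cnj (a l k s \<omega>) * a l j s \<omega> \<partial>M))"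
      unfolding inner_component_field[OF l s] a[symmetric]
      using int by (simp add: Bochner_Integration.integral_sum)
    \<comment> \<open>Correlations vanish for \<open>j \<noteq> k\<close> and do not depend on
      \<open>k\<close> for \<open>j = k\<close>, so only the trace of the Gram matrix is
      left.\<close>
    also have "\<dots> = (\<Sum>k\<in>idx l. \<Sum>j\<in>idx l. if j = k then
        inner_SU2 (phi l k s) (phi l k s) * (?S / complex_of_real (2 * l + 1)) else 0)"
      by (intro sum.cong refl) (subst corr, auto simp: l s)
    also have "\<dots> = (\<Sum>k\<in>idx l. inner_SU2 (phi l k s) (phi l k s)) * (?S / complex_of_real (2 * l + 1))"
      unfolding sum_distrib_right using finite_idx[OF l] by (simp only: sum.delta if_True cong: sum.cong)
    also have "\<dots> = ?S" unfolding sum_inner_phi[OF l s] using dimension_nonzero[OF l] by simp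
    finally show ?thesis .
  qed

  have variance: "complex_variance M (a l m s) = complex_variance M (a l n s)" if n: "n \<in> idx l" for n
  proof (cases "l = 0")
    \<comment> \<open>In degree 0 the mean may be non-zero, but 0 is the only index.\<close>
    case True
    with m n show ?thesis by (auto simp: idx_def)
  next
    case False
    have "complex_of_real (complex_variance M (a l k s)) = ?S / complex_of_real (2 * l + 1)"
      if k: "k \<in> idx l" for k
    proof -
      have "complex_of_real (complex_variance M (a l k s))
        = (\<integral>\<omega>. complex_of_real ((cmod (a l k s \<omega>))\<^sup>2) \<partial>M)"
        by (simp add: complex_variance_def mean[OF False k] del: of_real_power)
      also have "\<dots> = (\<integral>\<omega>. cnj (a l k s \<omega>) * a l k s \<omega> \<partial>M)"
        unfolding complex_norm_square by (simp add: mult.commute)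
      also have "\<dots> = ?S / complex_of_real (2 * l + 1)"
        by (subst corr[OF k l k s]) simp
      finally show ?thesis .
    qed
    from this[OF m] this[OF n]
    have "complex_of_real (complex_variance M (a l m s)) = complex_of_real (complex_variance M (a l n s))"
      by (simp only:)
    then show ?thesis by (simp only: of_real_eq_iff)
  qed

  \<comment> \<open>The free factor \<open>Z\<close> allows for both uses: the moment itself and the
    terms of the sum.\<close>
  have rel: "(\<integral>\<omega>. a l k s \<omega> * Z \<omega> \<partial>M) = (- 1) ^ nat \<lfloor>l - k\<rfloor> * (- 1) ^ nat \<lfloor>l - s\<rfloor> *
      (\<integral>\<omega>. cnj (?b l (- k) (- s) \<omega>) * Z \<omega> \<partial>M)" if "k \<in> idx l" for k Z
    unfolding a coeff_field_cnj[OF l s that, of X] by (simp add: mult.assoc)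
  have pseudo: "(\<integral>\<omega>. a l m s \<omega> * a l' m' s' \<omega> \<partial>M) =
       of_bool (- m = m') * (- 1) ^ nat \<lfloor>l - m\<rfloor> *
       (of_bool (l = l') / complex_of_real (2 * l + 1)) *
       (\<Sum>k\<in>idx l. (- 1) ^ nat \<lfloor>l - k\<rfloor> * (\<integral>\<omega>. a l k s \<omega> * a l (- k) s' \<omega> \<partial>M))"
  proof -
    \<comment> \<open>The sign of each term cancels the equal sign from \<open>rel\<close>. After
      the reflection \<open>k \<mapsto> - k\<close> the sum is
      \<open>(- 1) ^ nat \<lfloor>l - s\<rfloor>\<close> times the trace of the correlation matrix
      for \<open>(cnj X, X)\<close>.\<close>
    have "(\<Sum>k\<in>idx l. (- 1) ^ nat \<lfloor>l - k\<rfloor> * (\<integral>\<omega>. a l k s \<omega> * a l (- k) s' \<omega> \<partial>M))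
      = (\<Sum>k\<in>idx l. (- 1) ^ nat \<lfloor>l - s\<rfloor> * (\<integral>\<omega>. cnj (?b l (- k) (- s) \<omega>) * a l (- k) s' \<omega> \<partial>M))"
      by (intro sum.cong refl) (simp add: rel mult.assoc[symmetric] power_mult_distrib[symmetric])
    also have "\<dots> = (\<Sum>k\<in>idx l. (- 1) ^ nat \<lfloor>l - s\<rfloor> * (\<integral>\<omega>. cnj (?b l k (- s) \<omega>) * a l k s' \<omega> \<partial>M))"
      by (rule sum.reindex_bij_betw[OF bij_betw_uminus_idx[OF l]])
    finally have sum: "(\<Sum>k\<in>idx l. (- 1) ^ nat \<lfloor>l - k\<rfloor> * (\<integral>\<omega>. a l k s \<omega> * a l (- k) s' \<omega> \<partial>M))
      = (- 1) ^ nat \<lfloor>l - s\<rfloor> * (\<Sum>k\<in>idx l. \<integral>\<omega>. cnj (?b l k (- s) \<omega>) * a l k s' \<omega> \<partial>M)"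
      by (simp only: sum_distrib_left)
    have "(\<integral>\<omega>. cnj (?b l (- m) (- s) \<omega>) * a l' m' s' \<omega> \<partial>M)
      = of_bool (- m = m') * (of_bool (l = l') / complex_of_real (2 * l + 1)) *
        (\<Sum>k\<in>idx l. \<integral>\<omega>. cnj (?b l k (- s) \<omega>) * a l k s' \<omega> \<partial>M)"
      unfolding a
      by (rule jointly_left_invariant.coefficient_correlation[OF inv(2) l l'
            idx_uminus[OF l s] s' idx_uminus[OF l m] m'])
    then show ?thesis unfolding sum rel[OF m] by (simp only: mult_ac)
  qed

  \<comment> \<open>For \<open>s = s'\<close> the reflection \<open>k \<mapsto> - k\<close>
    exchanges two commuting factors. For integer \<open>l\<close> the two exponents add up to the
    even number \<open>2 * l\<close>, so they have the same parity.\<close>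
  have sign: "(\<Sum>k\<in>idx l. (- 1) ^ nat \<lfloor>l + k\<rfloor> * (\<integral>\<omega>. a l k s \<omega> * a l (- k) s' \<omega> \<partial>M))
    = (\<Sum>k\<in>idx l. (- 1) ^ nat \<lfloor>l - k\<rfloor> * (\<integral>\<omega>. a l k s \<omega> * a l (- k) s' \<omega> \<partial>M))"
    if "s = s' \<or> l \<in> \<nat>"
    using that
  proof
    assume "s = s'"
    have "(\<Sum>k\<in>idx l. (- 1) ^ nat \<lfloor>l + k\<rfloor> * (\<integral>\<omega>. a l k s \<omega> * a l (- k) s \<omega> \<partial>M))
      = (\<Sum>k\<in>idx l. (- 1) ^ nat \<lfloor>l + - k\<rfloor> * (\<integral>\<omega>. a l (- k) s \<omega> * a l (- (- k)) s \<omega> \<partial>M))"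
      by (rule sum.reindex_bij_betw[OF bij_betw_uminus_idx[OF l], symmetric])
    with \<open>s = s'\<close> show ?thesis by (simp add: mult.commute)
  next
    assume "l \<in> \<nat>"
    then obtain n where n: "l = real n" by (rule Nats_cases)
    have "(- 1 :: complex) ^ nat \<lfloor>l + k\<rfloor> = (- 1) ^ nat \<lfloor>l - k\<rfloor>" if "k \<in> idx l" for k
    proof -
      have "2 * l = real (2 * n)" by (simp add: n)
      then have "nat \<lfloor>l + k\<rfloor> + nat \<lfloor>l - k\<rfloor> = 2 * n"
        unfolding nat_floor_idx(3)[OF l that] by (simp only: floor_of_nat nat_int)
      then have "even (nat \<lfloor>l + k\<rfloor> + nat \<lfloor>l - k\<rfloor>)" by simp
      then show ?thesis by (auto simp: minus_one_power_iff)
    qed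
    then show ?thesis by simp
  qed

  have corr_component: "(\<integral>\<omega>. cnj (a l m s \<omega>) * a l' m' s' \<omega> \<partial>M) =
         of_bool (m = m') * (of_bool (l = l') / complex_of_real (2 * l + 1)) *
         (\<integral>\<omega>. inner_SU2 (component_field X l s \<omega>) (component_field X l s' \<omega>) \<partial>M)" if "s = s'"
    using corr[OF m l' m' s'] unfolding that[symmetric] component .

  show ?thesis
    by (intro conjI impI ballI meas[OF m] square mean[OF _ m] corr_component corr[OF m l' m' s'] variance pseudo;
        (assumption | (subst sign, assumption, rule pseudo)))
qed

end
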